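(* Let $(F,g_F)$ be a Riemannian manifold, and let $(\widetilde\nabla,\widetilde\nabla^* )$ be dually flat affine connections on $(F,g_F)$. Let $B=\mathbb{R}_{>0}$ with coordinate $t$ and metric $g_B=dt^2$, let $M=B\times F$ with the warped product metric $G=dt^2+t^2g_F$ (warping function $f(t)=t$), and let $(D,D^* )$ be dually flat affine connections on $(M,G)$. Assume that $D_XY$ is horizontal, i.e. $D_XY\in\mathcal{L}(B)$, for all $X,Y\in\mathcal{L}(B)$, and that $\mathrm{Ver}(D_VW)=\mathrm{Lift}(\widetilde\nabla_VW)$ for all $V,W\in\mathcal{L}(F)$. Define $k$ by $D_{\partial_t}\partial_t=k(t)\,\partial_t$, where $\partial_t=\frac{\partial}{\partial t}$. Then $$k(t)=\frac1t\quad\text{or}\quad k(t)=-\frac1t ,$$ that is, $D_{\partial_t}\partial_t=\frac1t\partial_t$ or $D_{\partial_t}\partial_t=-\frac1t\partial_t$.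
   Context: For an affine connection $\nabla$ on a Riemannian manifold $(N,g)$, the dual connection $\nabla^*$ is defined by $Xg(Y,Z)=g(\nabla_XY,Z)+g(Y,\nabla^*_XZ)$ for all vector fields $X,Y,Z$. The pair $(\nabla,\nabla^* )$ is called dually flat if $\nabla^*$ is the dual of $\nabla$ with respect to $g$ and the torsion and the curvature of both $\nabla$ and $\nabla^*$ vanish. On $M=B\times F$, $\mathcal{L}(B)$ and $\mathcal{L}(F)$ denote the sets of lifts to $M$ of vector fields on $B$ and on $F$, respectively. $\mathrm{Ver}$ denotes the projection of $TM$ onto $TF$. For $V,W\in\mathcal{L}(F)$, $\mathrm{Lift}(\widetilde\nabla_VW)$ is the lift to $M$ of the vector field on $F$ obtained by applying $\widetilde\nabla$ to the vector fields on $F$ of which $V,W$ are the lifts.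
   Formalization: The formal theorem assumes that F is nonempty and dim F ≥ 2; for dim F = 1 the claim fails, e.g. F = ℝ with g_F = dx² and all connections Levi-Civita gives k = 0, and for dim F = 0 the function k is arbitrary. *)

theory Defs
  imports "HOL-Analysis.Analysis"
begin

section \<open>Smooth functions on open subsets of Euclidean spaces\<close>

text \<open>Only meant for open sets: \<open>C_on k S f\<close> says that \<open>f\<close> is of class \<open>C^k\<close> on the open set \<open>S\<close>.\<close>

primrec C_on :: "nat \<Rightarrow> 'a::euclidean_space set \<Rightarrow> ('a \<Rightarrow> 'b::euclidean_space) \<Rightarrow> bool" where
  "C_on 0 S f \<longleftrightarrow> continuous_on S f"
| "C_on (Suc k) S f \<longleftrightarrow>
     (\<forall>x\<in>S. f differentiable (at x)) \<and> (\<forall>v. C_on k S (\<lambda>x. frechet_derivative f (at x) v))"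

definition smooth_on :: "'a::euclidean_space set \<Rightarrow> ('a \<Rightarrow> 'b::euclidean_space) \<Rightarrow> bool" where
  "smooth_on S f \<longleftrightarrow> (\<forall>k. C_on k S f)"


section \<open>Smooth manifolds\<close>

text \<open>
  A manifold is given by a (not necessarily maximal) smooth atlas. A chart is a pair of an open
  set of the ambient Hausdorff, second countable space and a coordinate map on it; the points of
  the manifold are those covered by the charts. The dimension is \<open>DIM('e)\<close>.
\<close>

type_synonym ('p, 'e) atlas = "('p set \<times> ('p \<Rightarrow> 'e)) set"

definition points :: "('p, 'e) atlas \<Rightarrow> 'p set" where
  "points A = (\<Union>(U, \<phi>)\<in>A. U)"

definition smooth_manifold ::
  "('p::{t2_space, second_countable_topology}, 'e::euclidean_space) atlas \<Rightarrow> bool" where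
  "smooth_manifold A \<longleftrightarrow>
     (\<forall>(U, \<phi>)\<in>A. open U \<and> open (\<phi> ` U) \<and> homeomorphism U (\<phi> ` U) \<phi> (inv_into U \<phi>)) \<and>
     (\<forall>(U, \<phi>)\<in>A. \<forall>(V, \<psi>)\<in>A. smooth_on (\<phi> ` (U \<inter> V)) (\<psi> \<circ> inv_into U \<phi>))"

text \<open>Values outside \<open>points A\<close> are irrelevant for membership in \<open>smooth_funs A\<close>.\<close>

definition smooth_funs :: "('p, 'e::euclidean_space) atlas \<Rightarrow> ('p \<Rightarrow> real) set" where
  "smooth_funs A = {f. \<forall>(U, \<phi>)\<in>A. smooth_on (\<phi> ` U) (f \<circ> inv_into U \<phi>)}"

definition product_manifold ::
  "('p, 'e) atlas \<Rightarrow> ('q, 'd) atlas \<Rightarrow> ('p \<times> 'q, 'e \<times> 'd) atlas" where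
  "product_manifold A B = {(U \<times> V, map_prod \<phi> \<psi>) |U \<phi> V \<psi>. (U, \<phi>) \<in> A \<and> (V, \<psi>) \<in> B}"


section \<open>Tangent vectors and vector fields\<close>

type_synonym 'p tangent = "('p \<Rightarrow> real) \<Rightarrow> real"
type_synonym 'p vfield = "'p \<Rightarrow> 'p tangent"

text \<open>
  Tangent vectors at \<open>p\<close> are the derivations at \<open>p\<close> of the algebra of smooth functions. They are
  set to 0 on non-smooth functions, so that equal derivations are equal as HOL functions.
  That they ignore the values of their argument outside \<open>points A\<close> follows from the Leibniz rule:
  if \<open>h\<close> vanishes on \<open>points A\<close>, then \<open>h = h * indicator (- points A)\<close>.
\<close>

definition tangent_space :: "('p, 'e::euclidean_space) atlas \<Rightarrow> 'p \<Rightarrow> 'p tangent set" where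
  "tangent_space A p = {v.
     (\<forall>f\<in>smooth_funs A. \<forall>h\<in>smooth_funs A. v (\<lambda>q. f q + h q) = v f + v h) \<and>
     (\<forall>c. \<forall>f\<in>smooth_funs A. v (\<lambda>q. c * f q) = c * v f) \<and>
     (\<forall>f\<in>smooth_funs A. \<forall>h\<in>smooth_funs A. v (\<lambda>q. f q * h q) = v f * h p + f p * v h) \<and>
     (\<forall>f. f \<notin> smooth_funs A \<longrightarrow> v f = 0)}"

text \<open>Vector fields are extended by 0 outside \<open>points A\<close>.\<close>

definition vector_fields :: "('p, 'e::euclidean_space) atlas \<Rightarrow> 'p vfield set" where
  "vector_fields A = {X.
     (\<forall>p\<in>points A. X p \<in> tangent_space A p) \<and>
     (\<forall>p. p \<notin> points A \<longrightarrow> X p = (\<lambda>f. 0)) \<and>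
     (\<forall>f\<in>smooth_funs A. (\<lambda>p. X p f) \<in> smooth_funs A)}"

definition vf_zero :: "'p vfield" where
  "vf_zero = (\<lambda>p f. 0)"

definition vf_add :: "'p vfield \<Rightarrow> 'p vfield \<Rightarrow> 'p vfield" where
  "vf_add X Y = (\<lambda>p f. X p f + Y p f)"

definition vf_diff :: "'p vfield \<Rightarrow> 'p vfield \<Rightarrow> 'p vfield" where
  "vf_diff X Y = (\<lambda>p f. X p f - Y p f)"

definition vf_scale :: "('p \<Rightarrow> real) \<Rightarrow> 'p vfield \<Rightarrow> 'p vfield" where
  "vf_scale h X = (\<lambda>p f. h p * X p f)"

definition lie_bracket :: "'p vfield \<Rightarrow> 'p vfield \<Rightarrow> 'p vfield" where
  "lie_bracket X Y = (\<lambda>p f. X p (\<lambda>q. Y q f) - Y p (\<lambda>q. X q f))"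

text \<open>
  The differential of a smooth map \<open>\<Phi>\<close> into the manifold with atlas \<open>B\<close>, applied to a tangent
  vector \<open>v\<close> of its source.
\<close>

definition pushforward ::
  "('q, 'd::euclidean_space) atlas \<Rightarrow> ('p \<Rightarrow> 'q) \<Rightarrow> 'p tangent \<Rightarrow> 'q tangent" where
  "pushforward B \<Phi> v = (\<lambda>f. if f \<in> smooth_funs B then v (f \<circ> \<Phi>) else 0)"


section \<open>Riemannian metrics and dually flat connections\<close>

text \<open>
  The value \<open>g p v w\<close> is only meaningful for \<open>p \<in> points A\<close> and tangent vectors \<open>v\<close>, \<open>w\<close> at \<open>p\<close>.
\<close>

type_synonym 'p metric_tensor = "'p \<Rightarrow> 'p tangent \<Rightarrow> 'p tangent \<Rightarrow> real"

definition riemannian_metric ::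
  "('p, 'e::euclidean_space) atlas \<Rightarrow> 'p metric_tensor \<Rightarrow> bool" where
  "riemannian_metric A g \<longleftrightarrow>
     (\<forall>p\<in>points A. \<forall>u\<in>tangent_space A p. \<forall>v\<in>tangent_space A p.
        g p u v = g p v u \<and>
        (\<forall>w\<in>tangent_space A p. g p (\<lambda>f. u f + v f) w = g p u w + g p v w) \<and>
        (\<forall>c. g p (\<lambda>f. c * u f) v = c * g p u v) \<and>
        (u \<noteq> (\<lambda>f. 0) \<longrightarrow> g p u u > 0)) \<and>
     (\<forall>X\<in>vector_fields A. \<forall>Y\<in>vector_fields A. (\<lambda>p. g p (X p) (Y p)) \<in> smooth_funs A)"

type_synonym 'p connection = "'p vfield \<Rightarrow> 'p vfield \<Rightarrow> 'p vfield"

definition affine_connection ::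
  "('p, 'e::euclidean_space) atlas \<Rightarrow> 'p connection \<Rightarrow> bool" where
  "affine_connection A D \<longleftrightarrow>
     (\<forall>X\<in>vector_fields A. \<forall>Y\<in>vector_fields A. D X Y \<in> vector_fields A) \<and>
     (\<forall>X\<in>vector_fields A. \<forall>X'\<in>vector_fields A. \<forall>Y\<in>vector_fields A.
        D (vf_add X X') Y = vf_add (D X Y) (D X' Y)) \<and>
     (\<forall>h\<in>smooth_funs A. \<forall>X\<in>vector_fields A. \<forall>Y\<in>vector_fields A.
        D (vf_scale h X) Y = vf_scale h (D X Y)) \<and>
     (\<forall>X\<in>vector_fields A. \<forall>Y\<in>vector_fields A. \<forall>Y'\<in>vector_fields A.
        D X (vf_add Y Y') = vf_add (D X Y) (D X Y')) \<and>
     (\<forall>c. \<forall>X\<in>vector_fields A. \<forall>Y\<in>vector_fields A.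
        D X (vf_scale (\<lambda>p. c) Y) = vf_scale (\<lambda>p. c) (D X Y)) \<and>
     (\<forall>h\<in>smooth_funs A. \<forall>X\<in>vector_fields A. \<forall>Y\<in>vector_fields A.
        D X (vf_scale h Y) = vf_add (vf_scale (\<lambda>p. X p h) Y) (vf_scale h (D X Y)))"

definition torsion :: "'p connection \<Rightarrow> 'p vfield \<Rightarrow> 'p vfield \<Rightarrow> 'p vfield" where
  "torsion D X Y = vf_diff (vf_diff (D X Y) (D Y X)) (lie_bracket X Y)"

definition curvature ::
  "'p connection \<Rightarrow> 'p vfield \<Rightarrow> 'p vfield \<Rightarrow> 'p vfield \<Rightarrow> 'p vfield" where
  "curvature D X Y Z = vf_diff (vf_diff (D X (D Y Z)) (D Y (D X Z))) (D (lie_bracket X Y) Z)"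

definition torsion_free :: "('p, 'e::euclidean_space) atlas \<Rightarrow> 'p connection \<Rightarrow> bool" where
  "torsion_free A D \<longleftrightarrow>
     (\<forall>X\<in>vector_fields A. \<forall>Y\<in>vector_fields A. torsion D X Y = vf_zero)"

definition flat :: "('p, 'e::euclidean_space) atlas \<Rightarrow> 'p connection \<Rightarrow> bool" where
  "flat A D \<longleftrightarrow>
     (\<forall>X\<in>vector_fields A. \<forall>Y\<in>vector_fields A. \<forall>Z\<in>vector_fields A. curvature D X Y Z = vf_zero)"

definition dual_connections ::
  "('p, 'e::euclidean_space) atlas \<Rightarrow> 'p metric_tensor \<Rightarrow> 'p connection \<Rightarrow> 'p connection \<Rightarrow> bool"
  where
  "dual_connections A g D D' \<longleftrightarrow>
     (\<forall>X\<in>vector_fields A. \<forall>Y\<in>vector_fields A. \<forall>Z\<in>vector_fields A. \<forall>p\<in>points A.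
        X p (\<lambda>q. g q (Y q) (Z q)) = g p (D X Y p) (Z p) + g p (Y p) (D' X Z p))"

definition dually_flat ::
  "('p, 'e::euclidean_space) atlas \<Rightarrow> 'p metric_tensor \<Rightarrow> 'p connection \<Rightarrow> 'p connection \<Rightarrow> bool"
  where
  "dually_flat A g D D' \<longleftrightarrow>
     affine_connection A D \<and> affine_connection A D' \<and> dual_connections A g D D' \<and>
     torsion_free A D \<and> torsion_free A D' \<and> flat A D \<and> flat A D'"


section \<open>Products: lifts, vertical projection, warped products\<close>

text \<open>
  The lift of a vector \<open>v\<close> tangent to a factor is the vector tangent to the product that projects to
  \<open>v\<close> in that factor and to 0 in the other one, i.e. the image of \<open>v\<close> under the differential of the
  inclusion of the factor as a slice.
\<close>

definition lift_base ::
  "('p, 'e::euclidean_space) atlas \<Rightarrow> ('q, 'd::euclidean_space) atlas \<Rightarrow>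
   'p vfield \<Rightarrow> ('p \<times> 'q) vfield" where
  "lift_base B F X = (\<lambda>(b, x).
     if (b, x) \<in> points (product_manifold B F)
     then pushforward (product_manifold B F) (\<lambda>b'. (b', x)) (X b) else (\<lambda>f. 0))"

definition lift_fibre ::
  "('p, 'e::euclidean_space) atlas \<Rightarrow> ('q, 'd::euclidean_space) atlas \<Rightarrow>
   'q vfield \<Rightarrow> ('p \<times> 'q) vfield" where
  "lift_fibre B F V = (\<lambda>(b, x).
     if (b, x) \<in> points (product_manifold B F)
     then pushforward (product_manifold B F) (\<lambda>x'. (b, x')) (V x) else (\<lambda>f. 0))"

definition base_lifts ::
  "('p, 'e::euclidean_space) atlas \<Rightarrow> ('q, 'd::euclidean_space) atlas \<Rightarrow> ('p \<times> 'q) vfield set"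
  where
  "base_lifts B F = lift_base B F ` vector_fields B"

definition ver ::
  "('p, 'e::euclidean_space) atlas \<Rightarrow> ('q, 'd::euclidean_space) atlas \<Rightarrow>
   ('p \<times> 'q) vfield \<Rightarrow> ('p \<times> 'q) vfield" where
  "ver B F Z = (\<lambda>(b, x).
     pushforward (product_manifold B F) (\<lambda>x'. (b, x')) (pushforward F snd (Z (b, x))))"

definition warped_metric ::
  "('p, 'e::euclidean_space) atlas \<Rightarrow> 'p metric_tensor \<Rightarrow> ('p \<Rightarrow> real) \<Rightarrow>
   ('q, 'd::euclidean_space) atlas \<Rightarrow> 'q metric_tensor \<Rightarrow> ('p \<times> 'q) metric_tensor" where
  "warped_metric B gB w F gF = (\<lambda>(b, x) u v.
     gB b (pushforward B fst u) (pushforward B fst v) +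
     (w b)\<^sup>2 * gF x (pushforward F snd u) (pushforward F snd v))"


section \<open>The half-line\<close>

definition half_line :: "(real, real) atlas" where
  "half_line = {({0<..}, \<lambda>t. t)}"

text \<open>The metric \<open>dt\<^sup>2\<close>: \<open>dt\<close> sends a tangent vector \<open>u\<close> to the derivative \<open>u t\<close> of the coordinate.\<close>

definition dt2 :: "real metric_tensor" where
  "dt2 = (\<lambda>t u v. u (\<lambda>s. s) * v (\<lambda>s. s))"

definition d_dt :: "real vfield" where
  "d_dt = (\<lambda>t f. if t \<in> points half_line \<and> f \<in> smooth_funs half_line then deriv f t else 0)"

text \<open>The coordinate field \<open>\<partial>\<^sub>t\<close> on the product of the half-line with \<open>F\<close>.\<close>

definition partial_t :: "('q, 'd::euclidean_space) atlas \<Rightarrow> (real \<times> 'q) vfield" where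
  "partial_t F = lift_base half_line F d_dt"

end

theory Submission
  imports Defs
begin

text \<open>
  Write \<open>T = \<partial>\<^sub>t\<close>, \<open>D\<^sub>T T = \<kappa> T\<close>, and let \<open>V, W, Z, U\<close> be lifts of vector fields on \<open>F\<close>. The
  slices \<open>{t} \<times> F\<close> have two second fundamental forms, one for each of the dual connections:
  by duality \<open>\<sigma>(V, W) = - G(T, D'\<^sub>V W) = G(D\<^sub>V T, W)\<close> and
  \<open>\<tau>(V, W) = - G(T, D\<^sub>V W) = G(D'\<^sub>V T, W)\<close>. Both are symmetric because the torsions vanish, and
  differentiating \<open>G(V, W) = t\<^sup>2 g(V, W)\<close> along \<open>T\<close> gives \<open>\<sigma> + \<tau> = 2 t g\<close>.

  The vanishing curvatures give two pieces of information. The radial part \<open>R(T, V) T = 0\<close> yields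
  a Riccati equation for each form, \<open>T \<sigma> = \<kappa> \<sigma> + G(D\<^sub>V T, D'\<^sub>W T)\<close> and
  \<open>T \<tau> = - \<kappa> \<tau> + G(D'\<^sub>V T, D\<^sub>W T)\<close> (\<open>T_\<sigma>\<close>, \<open>T_\<tau>\<close>). For \<open>V = W\<close> the quadratic terms agree, and
  together with the sum of the two forms this gives the linear equation
  \<open>T \<sigma>(V, V) = (1 + \<kappa> t) g(V, V)\<close> (\<open>T_\<sigma>_diagonal\<close>). In the Gauss equation, the fibre part of
  \<open>R(V, W) Z = 0\<close>, the curvature of the fibre connection drops out because that connection
  is flat too, and what remains is \<open>\<tau>(W, Z) \<sigma>(V, U) = \<tau>(V, Z) \<sigma>(W, U)\<close> (\<open>\<tau>_\<sigma>_exchange\<close>). In an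
  eigenbasis of \<open>\<sigma>\<close> with respect to \<open>g\<close> this says \<open>\<sigma>\<^sub>i \<tau>\<^sub>j = 0\<close> for \<open>i \<noteq> j\<close>; as \<open>\<sigma>\<^sub>j + \<tau>\<^sub>j = 2 t > 0\<close>
  and the dimension is at least two, either \<open>\<sigma> = 0\<close> or \<open>\<tau> = 0\<close> (\<open>\<sigma>_dichotomy\<close>). So
  \<open>\<sigma>(V, V) / g(V, V)\<close> is \<open>0\<close> or \<open>2 t\<close> for each \<open>t\<close>, by continuity it is the same alternative for all
  \<open>t\<close>, and comparing derivatives gives \<open>1 + \<kappa> t = 0\<close> or \<open>1 + \<kappa> t = 2\<close>.

  Tangent vectors are abstract derivations here, so the geometric computation rests on three analytic
  facts. A tangent vector of the product is determined by its radial component and its projection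
  to the fibre; this is Hadamard's lemma in the variable \<open>t\<close> (\<open>tangent_decomposition\<close>). Through every
  point of \<open>F\<close> there are two independent vector fields with smooth lifts, built from bump functions
  (\<open>independent_liftable_fields\<close>). And the fields with smooth lifts are closed under the fibre
  connection and the Lie bracket (\<open>N_liftable\<close>, \<open>up_lie_bracket\<close>), so that the computation never
  leaves them.
\<close>

section \<open>Calculus of \<open>C\<^sup>k\<close> functions\<close>

lemma C_on_cong_imp:
  assumes "open S" "\<And>x. x \<in> S \<Longrightarrow> f x = g x" "C_on k S f"
  shows "C_on k S g"
  using assms
proof (induction k arbitrary: f g)
  case 0
  then show ?case by (simp cong: continuous_on_cong)
next
  case (Suc k)
  have fd: "frechet_derivative g (at x) = frechet_derivative f (at x)" if "x \<in> S" for x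
    using frechet_derivative_transform_within_open[of f x S g] Suc.prems that by auto
  have "g differentiable (at x)" if "x \<in> S" for x
  proof -
    have "(f has_derivative frechet_derivative f (at x)) (at x)"
      using Suc.prems that frechet_derivative_works by auto
    then have "(g has_derivative frechet_derivative f (at x)) (at x)"
      using has_derivative_transform_within_open[OF _ Suc.prems(1) that] Suc.prems(2) by blast
    then show ?thesis by (auto simp: differentiable_def)
  qed
  moreover have "C_on k S (\<lambda>x. frechet_derivative g (at x) v)" for v
    by (rule Suc.IH[of "\<lambda>x. frechet_derivative f (at x) v"]) (use Suc.prems fd in auto)
  ultimately show ?case by simp
qed

text \<open>
  The Frechet derivative in the definition of \<open>C_on\<close> is a choice; this rule allows the derivative to
  be given by a formula instead.
\<close>

lemma C_on_SucI:
  assumes "open S" "\<And>x. x \<in> S \<Longrightarrow> (f has_derivative f' x) (at x)" "\<And>v. C_on k S (\<lambda>x. f' x v)"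
  shows "C_on (Suc k) S f"
proof -
  have "f' x = frechet_derivative f (at x)" if "x \<in> S" for x
    using assms(2)[OF that] frechet_derivative_at by blast
  then have "C_on k S (\<lambda>x. frechet_derivative f (at x) v)" for v
    by (intro C_on_cong_imp[OF assms(1) _ assms(3)[of v]]) auto
  then show ?thesis
    using assms(2) by (auto simp: differentiable_def)
qed

lemma C_on_Suc_derivative:
  assumes "C_on (Suc k) S f" "x \<in> S"
  shows "(f has_derivative frechet_derivative f (at x)) (at x)"
  using assms frechet_derivative_works by auto

lemma C_on_Suc_D: "C_on (Suc k) S f \<Longrightarrow> C_on k S (\<lambda>x. frechet_derivative f (at x) v)"
  by simp

lemma C_on_Suc_imp: "C_on (Suc k) S f \<Longrightarrow> C_on k S f"
proof (induction k arbitrary: f)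
  case 0
  then show ?case
    by (auto simp: differentiable_imp_continuous_within continuous_at_imp_continuous_on)
next
  case (Suc k)
  then show ?case by auto
qed

lemma C_on_subset: "C_on k S f \<Longrightarrow> T \<subseteq> S \<Longrightarrow> C_on k T f"
  by (induction k arbitrary: f) (auto intro: continuous_on_subset)

text \<open>
  Differentiability classes are local, so a function may be inspected near each point in whichever
  chart suits that point.
\<close>

lemma C_on_local:
  assumes "\<And>x. x \<in> S \<Longrightarrow> \<exists>T. open T \<and> x \<in> T \<and> C_on k T f"
  shows "C_on k S f"
  using assms
proof (induction k arbitrary: f)
  case 0
  show ?case
    unfolding C_on.simps
  proof (intro continuous_at_imp_continuous_on ballI)
    fix x assume "x \<in> S"
    then obtain T where "open T" "x \<in> T" "continuous_on T f" using 0 by auto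
    then show "isCont f x" using continuous_on_eq_continuous_at by blast
  qed
next
  case (Suc k)
  have "f differentiable (at x)" if "x \<in> S" for x
    using Suc.prems[OF that] C_on_Suc_derivative differentiable_def by blast
  moreover have "C_on k S (\<lambda>x. frechet_derivative f (at x) v)" for v
  proof (rule Suc.IH)
    fix x assume "x \<in> S"
    then obtain T where "open T" "x \<in> T" "C_on (Suc k) T f" using Suc.prems by blast
    then show "\<exists>T. open T \<and> x \<in> T \<and> C_on k T (\<lambda>x. frechet_derivative f (at x) v)" by auto
  qed
  ultimately show ?case by simp
qed

lemma C_on_const [simp]: "C_on k S (\<lambda>x. c)"
  by (induction k arbitrary: c) auto

lemma C_on_bounded_linear:
  assumes "open S" "bounded_linear f" shows "C_on k S f"
proof (cases k)
  case 0
  then show ?thesis using assms by (simp add: linear_continuous_on)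
next
  case (Suc k)
  show ?thesis unfolding Suc
    by (rule C_on_SucI[where f'="\<lambda>x. f"]) (use assms in \<open>auto intro: bounded_linear_imp_has_derivative\<close>)
qed

lemma C_on_add:
  assumes "open S" "C_on k S f" "C_on k S g" shows "C_on k S (\<lambda>x. f x + g x)"
  using assms(2,3)
proof (induction k arbitrary: f g)
  case 0
  then show ?case by (auto intro: continuous_intros)
next
  case (Suc k)
  show ?case
    by (rule C_on_SucI[OF assms(1),
          where f'="\<lambda>x v. frechet_derivative f (at x) v + frechet_derivative g (at x) v"])
       (use Suc in \<open>auto intro!: has_derivative_add C_on_Suc_derivative\<close>)
qed

lemma C_on_sum:
  assumes "open S" "\<And>i. i \<in> I \<Longrightarrow> C_on k S (f i)" shows "C_on k S (\<lambda>x. \<Sum>i\<in>I. f i x)"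
  using assms(2)
  by (induction I rule: infinite_finite_induct) (auto intro!: C_on_add assms(1))

lemma C_on_scaleR:
  assumes "open S" "C_on k S f" "C_on k S g" shows "C_on k S (\<lambda>x. f x *\<^sub>R g x)"
  using assms(2,3)
proof (induction k arbitrary: f g)
  case 0
  then show ?case by (auto intro: continuous_intros)
next
  case (Suc k)
  show ?case
  proof (rule C_on_SucI[OF assms(1)])
    show "((\<lambda>x. f x *\<^sub>R g x) has_derivative
        (\<lambda>v. f x *\<^sub>R frechet_derivative g (at x) v + frechet_derivative f (at x) v *\<^sub>R g x)) (at x)"
      if "x \<in> S" for x
      using Suc.prems that by (intro has_derivative_scaleR C_on_Suc_derivative)
    show "C_on k S (\<lambda>x. f x *\<^sub>R frechet_derivative g (at x) v + frechet_derivative f (at x) v *\<^sub>R g x)" for v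
      using Suc.prems Suc.prems[THEN C_on_Suc_imp]
      by (intro C_on_add assms Suc.IH C_on_Suc_D) auto
  qed
qed

lemma C_on_mult:
  fixes f g :: "'a::euclidean_space \<Rightarrow> real"
  assumes "open S" "C_on k S f" "C_on k S g" shows "C_on k S (\<lambda>x. f x * g x)"
  using C_on_scaleR[OF assms] by simp

text \<open>
  Expanding the inner derivative in the basis turns the chain rule into
  \<open>D(g \<circ> f)(x) v = (\<Sum>b\<in>Basis. (Df(x) v \<bullet> b) *\<^sub>R Dg(f x) b)\<close>. Each factor loses one degree of
  smoothness and is evaluated in a fixed direction, so induction on the class applies.
\<close>

lemma C_on_compose:
  assumes "open S" "open T" "C_on k T g" "C_on k S f" "f ` S \<subseteq> T"
  shows "C_on k S (\<lambda>x. g (f x))"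
  using assms(3,4)
proof (induction k arbitrary: g)
  case 0
  then show ?case using assms(5) by (auto intro: continuous_on_compose2)
next
  case (Suc k)
  let ?Df = "\<lambda>x. frechet_derivative f (at x)" and ?Dg = "\<lambda>x. frechet_derivative g (at x)"
  show ?case
  proof (rule C_on_SucI[OF assms(1)])
    show "((\<lambda>x. g (f x)) has_derivative (\<lambda>v. \<Sum>b\<in>Basis. (?Df x v \<bullet> b) *\<^sub>R ?Dg (f x) b)) (at x)"
      if "x \<in> S" for x
    proof -
      have g: "(g has_derivative ?Dg (f x)) (at (f x))"
        using C_on_Suc_derivative[OF Suc.prems(1)] assms(5) that by auto
      have "((\<lambda>x. g (f x)) has_derivative (\<lambda>v. ?Dg (f x) (?Df x v))) (at x)"
        using has_derivative_compose[OF C_on_Suc_derivative[OF Suc.prems(2) that] g] .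
      moreover have "(\<lambda>v. ?Dg (f x) (?Df x v)) = (\<lambda>v. \<Sum>b\<in>Basis. (?Df x v \<bullet> b) *\<^sub>R ?Dg (f x) b)"
      proof
        fix v
        let ?w = "?Df x v"
        interpret Dg: linear "?Dg (f x)" using g has_derivative_linear by blast
        have "?Dg (f x) ?w = ?Dg (f x) (\<Sum>b\<in>Basis. (?w \<bullet> b) *\<^sub>R b)" by (simp add: euclidean_representation)
        also have "\<dots> = (\<Sum>b\<in>Basis. (?w \<bullet> b) *\<^sub>R ?Dg (f x) b)"
          by (simp add: Dg.sum Dg.scale)
        finally show "?Dg (f x) ?w = (\<Sum>b\<in>Basis. (?w \<bullet> b) *\<^sub>R ?Dg (f x) b)" .
      qed
      ultimately show ?thesis by (simp only:)
    qed
    show "C_on k S (\<lambda>x. \<Sum>b\<in>Basis. (?Df x v \<bullet> b) *\<^sub>R ?Dg (f x) b)" for v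
    proof (intro C_on_sum C_on_scaleR assms(1))
      fix b :: 'b
      have D: "C_on k S (\<lambda>x. ?Df x v)" using Suc.prems(2) by simp
      \<comment> \<open>The inner product with a fixed vector is linear, so it commutes with the derivatives.\<close>
      have inner: "C_on j S (\<lambda>x. h x \<bullet> b)" if "C_on j S h" for j and h :: "'a \<Rightarrow> 'b"
        using that
      proof (induction j arbitrary: h)
        case 0
        then show ?case by (auto intro: continuous_intros)
      next
        case (Suc j)
        show ?case
          by (rule C_on_SucI[OF assms(1), where f'="\<lambda>x v. frechet_derivative h (at x) v \<bullet> b"])
             (use Suc in \<open>auto intro!: has_derivative_inner_left C_on_Suc_derivative\<close>)
      qed
      show "C_on k S (\<lambda>x. ?Df x v \<bullet> b)" by (rule inner[OF D])
      show "C_on k S (\<lambda>x. ?Dg (f x) b)"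
        using Suc.IH[OF C_on_Suc_D[OF Suc.prems(1)] C_on_Suc_imp[OF Suc.prems(2)]] .
    qed
  qed
qed

lemma C_on_bounded_linear_compose:
  assumes "open S" "bounded_linear L" "C_on k S f" shows "C_on k S (\<lambda>x. L (f x))"
  using C_on_compose[OF assms(1) open_UNIV C_on_bounded_linear[OF open_UNIV assms(2)] assms(3)] by simp

lemma C_on_Pair:
  assumes "open S" "C_on k S f" "C_on k S g" shows "C_on k S (\<lambda>x. (f x, g x))"
proof -
  have "C_on k S (\<lambda>x. (f x, 0) + (0, g x))"
    by (intro C_on_add assms C_on_bounded_linear_compose[OF assms(1) _ assms(2)]
          C_on_bounded_linear_compose[OF assms(1) _ assms(3)] bounded_linear_Pair
          bounded_linear_ident bounded_linear_zero)
  then show ?thesis by simp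
qed

section \<open>Bump functions\<close>

text \<open>
  The classical flat function is the case \<open>n = 0\<close>. Its derivatives are combinations of the other
  members, so that smoothness of the whole family is proved by one induction.
\<close>

definition flat_exp :: "nat \<Rightarrow> real \<Rightarrow> real" where
  "flat_exp n s = (if s > 0 then exp (- inverse s) * inverse s ^ n else 0)"

text \<open>
  Away from \<open>0\<close> this is the product rule. At \<open>0\<close> the difference quotient tends to \<open>0\<close> because the
  exponential beats every power of \<open>1 / s\<close>.
\<close>

lemma flat_exp_has_derivative:
  "(flat_exp n has_real_derivative (flat_exp (n + 2) s - real n * flat_exp (n + 1) s)) (at s)"
proof -
  consider "s > 0" | "s = 0" | "s < 0" by linarith
  then show ?thesis
  proof cases
    case 1
    let ?q = "inverse s"
    have "((\<lambda>s. exp (- inverse s) * inverse s ^ n) has_real_derivative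
            exp (- ?q) * ?q\<^sup>2 * ?q ^ n + exp (- ?q) * (real n * ?q ^ (n - 1) * (- (?q\<^sup>2)))) (at s)"
      using 1 by (auto intro!: derivative_eq_intros simp: power2_eq_square)
    also have "exp (- ?q) * ?q\<^sup>2 * ?q ^ n + exp (- ?q) * (real n * ?q ^ (n - 1) * (- (?q\<^sup>2)))
        = flat_exp (n + 2) s - real n * flat_exp (n + 1) s"
      using 1 by (cases n) (simp_all add: flat_exp_def power2_eq_square)
    finally have "((\<lambda>s. exp (- inverse s) * inverse s ^ n) has_real_derivative
            (flat_exp (n + 2) s - real n * flat_exp (n + 1) s)) (at s)" .
    then show ?thesis
      by (rule has_field_derivative_transform_within_open[of _ _ _ "{0<..}"])
         (use 1 in \<open>auto simp: flat_exp_def\<close>)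
  next
    case 2
    have lim: "((\<lambda>h. flat_exp n h / h) \<longlongrightarrow> 0) (at 0)"
    proof (rule filterlim_split_at)
      show "((\<lambda>h. flat_exp n h / h) \<longlongrightarrow> 0) (at_left 0)"
        by (rule tendsto_eventually, rule eventually_at_leftI[of "-1"]) (auto simp: flat_exp_def)
      have "((\<lambda>x::real. x ^ Suc n / exp x) \<longlongrightarrow> 0) at_top"
        by (rule tendsto_power_div_exp_0)
      then have "((\<lambda>h::real. inverse h ^ Suc n / exp (inverse h)) \<longlongrightarrow> 0) (at_right 0)"
        by (rule filterlim_compose[OF _ filterlim_inverse_at_top_right])
      then show "((\<lambda>h. flat_exp n h / h) \<longlongrightarrow> 0) (at_right 0)"
        by (rule Lim_transform_eventually)
           (auto simp: eventually_at_filter flat_exp_def exp_minus field_simps)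
    qed
    have "(flat_exp n has_real_derivative 0) (at 0)"
      using lim by (simp add: has_field_derivative_iff flat_exp_def)
    then show ?thesis using 2 by (simp add: flat_exp_def)
  next
    case 3
    have "(flat_exp n has_real_derivative 0) (at s)"
      by (rule has_field_derivative_transform_within_open[of "\<lambda>_. 0" _ _ "{..<0}"])
         (use 3 in \<open>auto simp: flat_exp_def\<close>)
    then show ?thesis using 3 by (simp add: flat_exp_def)
  qed
qed

lemma C_on_flat_exp: "C_on k UNIV (flat_exp n)"
proof (induction k arbitrary: n)
  case 0
  show ?case
    unfolding C_on.simps
    by (intro continuous_at_imp_continuous_on ballI DERIV_isCont[OF flat_exp_has_derivative])
next
  case (Suc k)
  show ?case
  proof (rule C_on_SucI)
    show "(flat_exp n has_derivative
        (\<lambda>v. (flat_exp (n + 2) x + (- real n) * flat_exp (n + 1) x) * v)) (at x)" for x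
      using flat_exp_has_derivative[of n x] by (simp add: has_field_derivative_def)
    show "C_on k UNIV (\<lambda>x. (flat_exp (n + 2) x + (- real n) * flat_exp (n + 1) x) * v)" for v
      by (intro C_on_mult C_on_add Suc.IH C_on_const) auto
  qed auto
qed

text \<open>
  The flat function composed with \<open>r\<^sup>2 - \<bar>y - c\<bar>\<^sup>2\<close>, which is positive exactly inside the ball, and
  normalised at the centre.
\<close>

lemma bump_function:
  fixes c :: "'a::euclidean_space"
  assumes "r > 0"
  obtains \<beta> :: "'a \<Rightarrow> real" where "\<And>k. C_on k UNIV \<beta>" "\<beta> c = 1" "\<And>y. y \<notin> cball c r \<Longrightarrow> \<beta> y = 0"
proof
  let ?q = "\<lambda>y. r\<^sup>2 - (y - c) \<bullet> (y - c)"
  let ?b = "\<lambda>y. inverse (flat_exp 0 (r\<^sup>2)) * flat_exp 0 (?q y)"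
  have q: "C_on k UNIV ?q" for k
  proof -
    have lin: "C_on k UNIV (\<lambda>y. y \<bullet> b - c \<bullet> b)" for b :: 'a
    proof -
      have "C_on k UNIV (\<lambda>y::'a. y \<bullet> b + - (c \<bullet> b))"
        by (intro C_on_add C_on_const C_on_bounded_linear open_UNIV bounded_linear_inner_left)
      then show ?thesis by simp
    qed
    have "C_on k UNIV (\<lambda>y. r\<^sup>2 + (-1) * (\<Sum>b\<in>Basis. (y \<bullet> b - c \<bullet> b) * (y \<bullet> b - c \<bullet> b)))"
      by (intro C_on_add C_on_const C_on_mult C_on_sum lin open_UNIV)
    moreover have "(y - c) \<bullet> (y - c) = (\<Sum>b\<in>Basis. (y \<bullet> b - c \<bullet> b) * (y \<bullet> b - c \<bullet> b))" for y
      by (subst euclidean_inner) (simp add: inner_diff_left)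
    ultimately show ?thesis by simp
  qed
  show "C_on k UNIV ?b" for k
    by (intro C_on_mult C_on_const C_on_compose[OF _ open_UNIV C_on_flat_exp q]) auto
  show "?b c = 1" using assms by (simp add: flat_exp_def)
  show "?b y = 0" if "y \<notin> cball c r" for y
  proof -
    have "r < norm (y - c)" using that by (simp add: dist_norm norm_minus_commute)
    then have "r\<^sup>2 < (norm (y - c))\<^sup>2" using assms by (intro power_strict_mono) auto
    then show ?thesis by (simp add: flat_exp_def dot_square_norm)
  qed
qed

section \<open>Hadamard quotients\<close>

lemma segment_in_interval:
  fixes J :: "real set"
  assumes "convex J" "t \<in> J" "s \<in> J" "u \<in> {0..1}"
  shows "t + u * (s - t) \<in> J"
proof -
  have "(1 - u) *\<^sub>R t + u *\<^sub>R s \<in> J" using assms by (intro convexD) auto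
  then show ?thesis by (simp add: algebra_simps)
qed

lemma continuous_on_segment:
  fixes h :: "real \<times> 'd::topological_space \<Rightarrow> real"
  assumes "convex J" "t \<in> J" "continuous_on (J \<times> \<Omega>) h"
  shows "continuous_on ((J \<times> \<Omega>) \<times> {0..1}) (\<lambda>p. h (t + snd p * (fst (fst p) - t), snd (fst p)))"
proof (rule continuous_on_compose2[OF assms(3)])
  show "continuous_on ((J \<times> \<Omega>) \<times> {0..1}) (\<lambda>p. (t + snd p * (fst (fst p) - t), snd (fst p)))"
    by (intro continuous_intros)
qed (use segment_in_interval[OF assms(1,2)] in auto)

text \<open>
  Differentiating under the integral sign reproduces integrals of the same shape for the
  derivatives of \<open>g\<close>: in the first variable the weight \<open>w(u)\<close> turns into \<open>w(u) u\<close>, in the other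
  variables it stays. This is why the statement carries a weight.
\<close>

lemma C_on_integral_segment:
  fixes g :: "real \<times> 'd::euclidean_space \<Rightarrow> real" and w :: "real \<Rightarrow> real"
  assumes "open J" "convex J" "t \<in> J" "open \<Omega>" "continuous_on {0..1} w" "C_on k (J \<times> \<Omega>) g"
  shows "C_on k (J \<times> \<Omega>) (\<lambda>z. integral {0..1} (\<lambda>u. w u * g (t + u * (fst z - t), snd z)))"
  using assms(5,6)
proof (induction k arbitrary: g w)
  case 0
  have "continuous_on ((J \<times> \<Omega>) \<times> {0..1}) (\<lambda>p. w (snd p) * g (t + snd p * (fst (fst p) - t), snd (fst p)))"
    using 0 by (intro continuous_on_mult continuous_on_segment assms
        continuous_on_compose2[OF 0(1) continuous_on_snd[OF continuous_on_id]]) auto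
  then show ?case
    using integral_continuous_on_param[where a=0 and b="1::real" and U="J \<times> \<Omega>"
        and f="\<lambda>z u. w u * g (t + u * (fst z - t), snd z)"] by (simp add: split_beta)
next
  case (Suc k)
  have pt: "(t + u * (fst z - t), snd z) \<in> J \<times> \<Omega>" if "z \<in> J \<times> \<Omega>" "u \<in> {0..1}" for z u
    using segment_in_interval[OF assms(2,3)] that by auto
  let ?Dg = "\<lambda>z. frechet_derivative g (at z)"
  let ?A = "\<lambda>z u. (t + u * (fst z - t), snd z)"
  let ?I = "\<lambda>w h z. integral {0..1} (\<lambda>u. w u * h (?A z u))"
  have op: "open (J \<times> \<Omega>)" using assms by (intro open_Times)
  have Dg: "(g has_derivative ?Dg z) (at z)" if "z \<in> J \<times> \<Omega>" for z
    using C_on_Suc_derivative[OF Suc.prems(2) that] .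
  have Dg_split: "?Dg z (a, b) = a * ?Dg z (1, 0) + ?Dg z (0, b)" if "z \<in> J \<times> \<Omega>" for z a b
  proof -
    interpret L: linear "?Dg z" using Dg[OF that] has_derivative_linear by blast
    have "?Dg z (a, b) = ?Dg z (a *\<^sub>R (1, 0) + (0, b))" by simp
    also have "\<dots> = a * ?Dg z (1, 0) + ?Dg z (0, b)" by (simp only: L.add L.scale real_scaleR_def)
    finally show ?thesis .
  qed
  have cont_w: "continuous_on ((J \<times> \<Omega>) \<times> {0..1}) (\<lambda>p. w (snd p))"
    by (rule continuous_on_compose2[OF Suc.prems(1)]) (auto intro: continuous_intros)
  have cont_Dg: "continuous_on ((J \<times> \<Omega>) \<times> {0..1}) (\<lambda>p. ?Dg (?A (fst p) (snd p)) v)" for v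
  proof -
    have "C_on 0 (J \<times> \<Omega>) (\<lambda>z. ?Dg z v)"
    proof -
      have "C_on k (J \<times> \<Omega>) (\<lambda>z. ?Dg z v)" using Suc.prems(2) by (rule C_on_Suc_D)
      then show ?thesis by (induction k) (auto dest: C_on_Suc_imp simp del: C_on.simps)
    qed
    then have c: "continuous_on (J \<times> \<Omega>) (\<lambda>z. ?Dg z v)" by simp
    show ?thesis using continuous_on_segment[OF assms(2,3) c] .
  qed
  show ?case
  proof (rule C_on_SucI[OF op])
    fix z assume z: "z \<in> J \<times> \<Omega>"
    obtain e where e: "e > 0" "ball z e \<subseteq> J \<times> \<Omega>" using op z openE by blast
    define L where "L = (\<lambda>z u. Blinfun (\<lambda>v. w u * ?Dg (?A z u) (u * fst v, snd v)))"
    have L: "blinfun_apply (L z u) = (\<lambda>v. w u * ?Dg (?A z u) (u * fst v, snd v))"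
      if "z \<in> J \<times> \<Omega>" "u \<in> {0..1}" for z u
    proof -
      have "bounded_linear (\<lambda>v. ?Dg (?A z u) (u * fst v, snd v))"
        by (rule bounded_linear_compose[OF has_derivative_bounded_linear[OF Dg[OF pt[OF that]]]])
           (intro bounded_linear_intros)
      then show ?thesis
        unfolding L_def by (intro bounded_linear_Blinfun_apply bounded_linear_const_mult)
    qed
    have cont_L: "continuous_on ((J \<times> \<Omega>) \<times> {0..1}) (\<lambda>(z, u). L z u)"
    proof (rule continuous_on_blinfun_componentwise)
      fix i :: "real \<times> 'd"
      have "continuous_on ((J \<times> \<Omega>) \<times> {0..1}) (\<lambda>p. w (snd p) * (snd p * fst i * ?Dg (?A (fst p) (snd p)) (1, 0)
             + ?Dg (?A (fst p) (snd p)) (0, snd i)))"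
        by (intro continuous_intros cont_w cont_Dg)
      then show "continuous_on ((J \<times> \<Omega>) \<times> {0..1}) (\<lambda>p. blinfun_apply (case p of (z, u) \<Rightarrow> L z u) i)"
      proof (rule continuous_on_eq, clarify)
        fix s y u assume "s \<in> J" "y \<in> \<Omega>" and u: "u \<in> {0..1::real}"
        then have z: "(s, y) \<in> J \<times> \<Omega>" by simp
        show "w (snd ((s, y), u)) * (snd ((s, y), u) * fst i * ?Dg (?A (fst ((s, y), u)) (snd ((s, y), u))) (1, 0)
             + ?Dg (?A (fst ((s, y), u)) (snd ((s, y), u))) (0, snd i)) = blinfun_apply (L (s, y) u) i"
          unfolding L[OF z u] by (simp add: Dg_split[OF pt[OF z u], symmetric, simplified])
      qed
    qed
    have der: "(?I w g has_derivative blinfun_apply (integral (cbox 0 1) (L z))) (at z within ball z e)"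
      unfolding box_real[symmetric]
    proof (rule leibniz_rule[where U="ball z e" and fx=L])
      fix z' u assume zu: "z' \<in> ball z e" "u \<in> cbox 0 (1::real)"
      then have z': "z' \<in> J \<times> \<Omega>" and u: "u \<in> {0..1}" using e by auto
      have A: "((\<lambda>z. ?A z u) has_derivative (\<lambda>v. (u * fst v, snd v))) (at z' within ball z e)"
        by (auto intro!: derivative_eq_intros)
      show "((\<lambda>z. w u * g (?A z u)) has_derivative blinfun_apply (L z' u)) (at z' within ball z e)"
        unfolding L[OF z' u]
        by (rule has_derivative_mult_right)
           (rule has_derivative_compose[OF A Dg[OF pt[OF z' u]]])
    next
      fix z' assume "z' \<in> ball z e"
      then have z': "z' \<in> J \<times> \<Omega>" using e by auto
      have "C_on 0 (J \<times> \<Omega>) g"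
      proof -
        have "C_on k (J \<times> \<Omega>) g" using C_on_Suc_imp[OF Suc.prems(2)] .
        then show ?thesis by (induction k) (auto dest: C_on_Suc_imp simp del: C_on.simps)
      qed
      then have c: "continuous_on (J \<times> \<Omega>) g" by simp
      have "continuous_on {0..1} (\<lambda>u. w u * g (?A z' u))"
        by (intro continuous_intros Suc.prems(1) continuous_on_compose2[OF c]) (use pt[OF z'] in auto)
      then show "(\<lambda>u. w u * g (?A z' u)) integrable_on cbox 0 1"
        by (simp add: integrable_continuous_real)
    next
      show "continuous_on (ball z e \<times> cbox 0 1) (\<lambda>(z, u). L z u)"
        using cont_L by (rule continuous_on_subset) (use e in auto)
    qed (use e in auto)
    have "blinfun_apply (integral (cbox 0 1) (L z)) v =
        fst v * ?I (\<lambda>u. w u * u) (\<lambda>z. ?Dg z (1, 0)) z + ?I w (\<lambda>z. ?Dg z (0, snd v)) z" for v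
    proof -
      have "continuous_on {0..1} (\<lambda>u. case (z, u) of (z, u) \<Rightarrow> L z u)"
        by (rule continuous_on_compose2[OF cont_L]) (use z in \<open>auto intro!: continuous_intros\<close>)
      then have int: "L z integrable_on cbox 0 1" by (simp add: integrable_continuous_real)
      have cD: "continuous_on {0..1} (\<lambda>u. ?Dg (?A z u) v)" for v
      proof -
        have "continuous_on {0..1} (\<lambda>u. (z, u))" by (intro continuous_intros)
        moreover have "(\<lambda>u. (z, u)) ` {0..1} \<subseteq> (J \<times> \<Omega>) \<times> {0..1}" using z by auto
        ultimately show ?thesis using continuous_on_compose2[OF cont_Dg, of "{0..1}" "\<lambda>u. (z, u)" v] by simp
      qed
      have "blinfun_apply (integral (cbox 0 1) (L z)) v = integral {0..1} (\<lambda>u. blinfun_apply (L z u) v)"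
        using blinfun_apply_integral[OF int, of v] by simp
      also have "\<dots> = integral {0..1} (\<lambda>u. fst v * (w u * u * ?Dg (?A z u) (1, 0)) + w u * ?Dg (?A z u) (0, snd v))"
      proof (rule integral_cong)
        fix u :: real assume u: "u \<in> {0..1}"
        show "blinfun_apply (L z u) v =
            fst v * (w u * u * ?Dg (?A z u) (1, 0)) + w u * ?Dg (?A z u) (0, snd v)"
          unfolding L[OF z u] using Dg_split[OF pt[OF z u], of "u * fst v" "snd v"]
          by (simp only:) (simp add: algebra_simps)
      qed
      also have "\<dots> = integral {0..1} (\<lambda>u. fst v * (w u * u * ?Dg (?A z u) (1, 0)))
           + integral {0..1} (\<lambda>u. w u * ?Dg (?A z u) (0, snd v))"
        by (intro integral_add integrable_continuous_real continuous_intros Suc.prems(1) cD)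
      finally show ?thesis by simp
    qed
    then have "blinfun_apply (integral (cbox 0 1) (L z)) =
       (\<lambda>v. fst v * ?I (\<lambda>u. w u * u) (\<lambda>z. ?Dg z (1, 0)) z + ?I w (\<lambda>z. ?Dg z (0, snd v)) z)" ..
    with der show "(?I w g has_derivative
        (\<lambda>v. fst v * ?I (\<lambda>u. w u * u) (\<lambda>z. ?Dg z (1, 0)) z + ?I w (\<lambda>z. ?Dg z (0, snd v)) z)) (at z)"
      using at_within_open[of z "ball z e"] e by simp
  next
    fix v
    show "C_on k (J \<times> \<Omega>) (\<lambda>z. fst v * ?I (\<lambda>u. w u * u) (\<lambda>z. ?Dg z (1, 0)) z + ?I w (\<lambda>z. ?Dg z (0, snd v)) z)"
      by (intro C_on_add C_on_mult C_on_const op Suc.IH C_on_Suc_D Suc.prems continuous_intros)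
  qed
qed

text \<open>
  The fundamental theorem of calculus along the segment from \<open>(t, y)\<close> to \<open>(s, y)\<close>. It displays the
  quotient of \<open>g (s, y) - g (t, y)\<close> by \<open>s - t\<close> as an integral, which is as smooth as the derivative of \<open>g\<close>
  also where \<open>s = t\<close>.
\<close>

lemma integral_segment_derivative:
  fixes g :: "real \<times> 'd::euclidean_space \<Rightarrow> real"
  assumes "convex J" "t \<in> J" "s \<in> J" "y \<in> \<Omega>" "C_on 1 (J \<times> \<Omega>) g"
  shows "g (s, y) = g (t, y) +
     (s - t) * integral {0..1} (\<lambda>u. frechet_derivative g (at (t + u * (s - t), y)) (1, 0))"
proof -
  let ?Dg = "\<lambda>z. frechet_derivative g (at z)"
  have pt: "(t + u * (s - t), y) \<in> J \<times> \<Omega>" if "u \<in> {0..1}" for u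
    using segment_in_interval[OF assms(1,2,3)] assms(4) that by auto
  have "((\<lambda>u. g (t + u * (s - t), y)) has_vector_derivative (s - t) * ?Dg (t + u * (s - t), y) (1, 0))
      (at u within {0..1})" if "u \<in> {0..1}" for u
  proof -
    have D: "(g has_derivative ?Dg (t + u * (s - t), y)) (at (t + u * (s - t), y))"
      by (rule C_on_Suc_derivative[where k=0 and S="J \<times> \<Omega>"])
         (use assms(5) pt[OF that] in \<open>auto simp del: C_on.simps\<close>)
    interpret L: linear "?Dg (t + u * (s - t), y)" using D has_derivative_linear by blast
    have A: "((\<lambda>u. (t + u * (s - t), y)) has_derivative (\<lambda>v. (v * (s - t)) *\<^sub>R (1, 0))) (at u within {0..1})"
      by (auto intro!: derivative_eq_intros)
    show ?thesis
      unfolding has_vector_derivative_def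
      using has_derivative_compose[OF A D] by (simp only: L.scale real_scaleR_def) (simp add: mult.assoc)
  qed
  then have "((\<lambda>u. (s - t) * ?Dg (t + u * (s - t), y) (1, 0)) has_integral
       g (t + 1 * (s - t), y) - g (t + 0 * (s - t), y)) {0..1}"
    by (intro fundamental_theorem_of_calculus) auto
  from integral_unique[OF this] show ?thesis by simp
qed

section \<open>Smooth functions and vector fields on manifolds\<close>

lemma smooth_on_add: "open S \<Longrightarrow> smooth_on S f \<Longrightarrow> smooth_on S g \<Longrightarrow> smooth_on S (\<lambda>x. f x + g x)"
  by (simp add: smooth_on_def C_on_add)

lemma smooth_on_mult:
  fixes f g :: "'a::euclidean_space \<Rightarrow> real"
  shows "open S \<Longrightarrow> smooth_on S f \<Longrightarrow> smooth_on S g \<Longrightarrow> smooth_on S (\<lambda>x. f x * g x)"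
  by (simp add: smooth_on_def C_on_mult)

lemma smooth_on_const: "smooth_on S (\<lambda>x. c)"
  by (simp add: smooth_on_def)

lemma smooth_on_bounded_linear: "open S \<Longrightarrow> bounded_linear f \<Longrightarrow> smooth_on S f"
  by (simp add: smooth_on_def C_on_bounded_linear)

lemma smooth_on_Pair: "open S \<Longrightarrow> smooth_on S f \<Longrightarrow> smooth_on S g \<Longrightarrow> smooth_on S (\<lambda>x. (f x, g x))"
  by (simp add: smooth_on_def C_on_Pair)

lemma smooth_on_compose:
  "open S \<Longrightarrow> open T \<Longrightarrow> smooth_on T g \<Longrightarrow> smooth_on S f \<Longrightarrow> f ` S \<subseteq> T \<Longrightarrow> smooth_on S (\<lambda>x. g (f x))"
  by (simp add: smooth_on_def C_on_compose)

lemma smooth_on_cong: "open S \<Longrightarrow> smooth_on S f \<Longrightarrow> (\<And>x. x \<in> S \<Longrightarrow> f x = g x) \<Longrightarrow> smooth_on S g"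
  unfolding smooth_on_def using C_on_cong_imp by blast

lemma smooth_on_local:
  assumes "\<And>x. x \<in> S \<Longrightarrow> \<exists>T. open T \<and> x \<in> T \<and> smooth_on T f"
  shows "smooth_on S f"
  unfolding smooth_on_def
proof (intro allI C_on_local)
  fix k x assume "x \<in> S"
  then show "\<exists>T. open T \<and> x \<in> T \<and> C_on k T f" using assms smooth_on_def by blast
qed

lemma smooth_on_derivative: "smooth_on S f \<Longrightarrow> smooth_on S (\<lambda>x. frechet_derivative f (at x) v)"
  unfolding smooth_on_def using C_on_Suc_D by blast

lemma smooth_on_has_derivative:
  "smooth_on S f \<Longrightarrow> x \<in> S \<Longrightarrow> (f has_derivative frechet_derivative f (at x)) (at x)"
  unfolding smooth_on_def using C_on_Suc_derivative by blast

lemma smooth_chart: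
  assumes "smooth_manifold A" "(U, \<phi>) \<in> A"
  shows "open U" "open (\<phi> ` U)" "homeomorphism U (\<phi> ` U) \<phi> (inv_into U \<phi>)" "inj_on \<phi> U" "U \<subseteq> points A"
proof -
  show 1: "open U" "open (\<phi> ` U)" "homeomorphism U (\<phi> ` U) \<phi> (inv_into U \<phi>)"
    using assms unfolding smooth_manifold_def by fast+
  show "inj_on \<phi> U"
    using 1(3) by (metis homeomorphism_def inj_on_inverseI)
  show "U \<subseteq> points A" using assms(2) by (auto simp: points_def)
qed

lemma open_chart_image:
  assumes "smooth_manifold A" "(U, \<phi>) \<in> A" "open W"
  shows "open (\<phi> ` (U \<inter> W))"
proof -
  note c = smooth_chart[OF assms(1,2)]
  have "openin (top_of_set (\<phi> ` U)) (\<phi> ` (U \<inter> W))"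
    by (rule homeomorphism_imp_open_map[OF c(3)]) (use assms(3) in auto)
  then show ?thesis using c(2) openin_open_trans by blast
qed

lemma transition_smooth:
  assumes "smooth_manifold A" "(U, \<phi>) \<in> A" "(V, \<psi>) \<in> A"
  shows "smooth_on (\<phi> ` (U \<inter> V)) (\<psi> \<circ> inv_into U \<phi>)"
  using assms unfolding smooth_manifold_def by fast

lemma smooth_funsD:
  "f \<in> smooth_funs A \<Longrightarrow> (U, \<phi>) \<in> A \<Longrightarrow> smooth_on (\<phi> ` U) (\<lambda>y. f (inv_into U \<phi> y))"
  unfolding smooth_funs_def comp_def by fast

lemma smooth_funsI:
  "(\<And>U \<phi>. (U, \<phi>) \<in> A \<Longrightarrow> smooth_on (\<phi> ` U) (\<lambda>y. f (inv_into U \<phi> y))) \<Longrightarrow> f \<in> smooth_funs A"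
  unfolding smooth_funs_def comp_def by fast

lemma smooth_funs_const: "(\<lambda>p. c) \<in> smooth_funs A"
  by (rule smooth_funsI) (rule smooth_on_const)

context
  fixes A :: "('p::{t2_space, second_countable_topology}, 'e::euclidean_space) atlas"
  assumes A: "smooth_manifold A"
begin

lemma smooth_funs_add:
  "f \<in> smooth_funs A \<Longrightarrow> h \<in> smooth_funs A \<Longrightarrow> (\<lambda>p. f p + h p) \<in> smooth_funs A"
  by (rule smooth_funsI, rule smooth_on_add) (auto intro: smooth_chart[OF A] smooth_funsD)

lemma smooth_funs_mult:
  "f \<in> smooth_funs A \<Longrightarrow> h \<in> smooth_funs A \<Longrightarrow> (\<lambda>p. f p * h p) \<in> smooth_funs A"
  by (rule smooth_funsI, rule smooth_on_mult) (auto intro: smooth_chart[OF A] smooth_funsD)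

lemma smooth_funs_minus: "f \<in> smooth_funs A \<Longrightarrow> (\<lambda>p. - f p) \<in> smooth_funs A"
  using smooth_funs_mult[OF smooth_funs_const[of "-1"]] by simp

lemma smooth_funs_diff:
  "f \<in> smooth_funs A \<Longrightarrow> h \<in> smooth_funs A \<Longrightarrow> (\<lambda>p. f p - h p) \<in> smooth_funs A"
  using smooth_funs_add[OF _ smooth_funs_minus] by simp

lemma smooth_funs_cong_imp:
  assumes "\<And>p. p \<in> points A \<Longrightarrow> f p = h p" "f \<in> smooth_funs A" shows "h \<in> smooth_funs A"
proof (rule smooth_funsI)
  fix U \<phi> assume U: "(U, \<phi>) \<in> A"
  have "f (inv_into U \<phi> y) = h (inv_into U \<phi> y)" if "y \<in> \<phi> ` U" for y
    using inv_into_into[OF that] smooth_chart(5)[OF A U] assms(1) by blast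
  then show "smooth_on (\<phi> ` U) (\<lambda>y. h (inv_into U \<phi> y))"
    by (rule smooth_on_cong[OF smooth_chart(2)[OF A U] smooth_funsD[OF assms(2) U]])
qed

text \<open>
  Around a point of \<open>U\<close> the function is the given local expression after a change of coordinates;
  around a point outside \<open>U\<close> it vanishes, because such a point has a neighbourhood that misses
  the closed set \<open>K\<close>.
\<close>

lemma smooth_funs_extend:
  assumes U: "(U, \<phi>) \<in> A" and K: "closed K" "K \<inter> points A \<subseteq> U"
    and g: "smooth_on (\<phi> ` U) (\<lambda>y. g (inv_into U \<phi> y))" "\<And>p. p \<in> points A \<Longrightarrow> p \<notin> K \<Longrightarrow> g p = 0"
  shows "g \<in> smooth_funs A"
proof (rule smooth_funsI, rule smooth_on_local)
  fix V \<psi> y assume V: "(V, \<psi>) \<in> A" and y: "y \<in> \<psi> ` V"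
  note cU = smooth_chart[OF A U] and cV = smooth_chart[OF A V]
  obtain p where p: "p \<in> V" "y = \<psi> p" using y by blast
  show "\<exists>T. open T \<and> y \<in> T \<and> smooth_on T (\<lambda>y. g (inv_into V \<psi> y))"
  proof (cases "p \<in> U")
    case True
    let ?T = "\<psi> ` (V \<inter> U)"
    have T: "open ?T" by (rule open_chart_image[OF A V cU(1)])
    have tr: "smooth_on ?T (\<lambda>y. \<phi> (inv_into V \<psi> y))"
      using transition_smooth[OF A V U] by (simp add: comp_def)
    have im: "(\<lambda>y. \<phi> (inv_into V \<psi> y)) ` ?T \<subseteq> \<phi> ` U"
      using cV(4) by (auto simp: inv_into_f_f)
    have "smooth_on ?T (\<lambda>y. g (inv_into U \<phi> (\<phi> (inv_into V \<psi> y))))"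
      using smooth_on_compose[OF T cU(2) g(1) tr im] .
    moreover have "g (inv_into U \<phi> (\<phi> (inv_into V \<psi> y))) = g (inv_into V \<psi> y)" if "y \<in> ?T" for y
      using that cU(4) cV(4) by (auto simp: inv_into_f_f)
    ultimately have "smooth_on ?T (\<lambda>y. g (inv_into V \<psi> y))"
      by (rule smooth_on_cong[OF T])
    then show ?thesis using T p True by blast
  next
    case False
    let ?T = "\<psi> ` (V \<inter> - K)"
    have T: "open ?T" by (rule open_chart_image[OF A V]) (use K in auto)
    have "g (inv_into V \<psi> y) = 0" if "y \<in> ?T" for y
      using that cV(4,5) g(2) by (auto simp: inv_into_f_f)
    then have "smooth_on ?T (\<lambda>y. g (inv_into V \<psi> y))"
      by (intro smooth_on_cong[OF T smooth_on_const[of _ 0]]) simp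
    moreover have "p \<notin> K" using False K(2) p(1) cV(5) by auto
    ultimately show ?thesis using T p by blast
  qed
qed

lemma tangent_add:
  "v \<in> tangent_space A p \<Longrightarrow> f \<in> smooth_funs A \<Longrightarrow> h \<in> smooth_funs A \<Longrightarrow> v (\<lambda>q. f q + h q) = v f + v h"
  by (simp add: tangent_space_def)

lemma tangent_scale:
  "v \<in> tangent_space A p \<Longrightarrow> f \<in> smooth_funs A \<Longrightarrow> v (\<lambda>q. c * f q) = c * v f"
  by (simp add: tangent_space_def)

lemma tangent_mult:
  "v \<in> tangent_space A p \<Longrightarrow> f \<in> smooth_funs A \<Longrightarrow> h \<in> smooth_funs A \<Longrightarrow>
    v (\<lambda>q. f q * h q) = v f * h p + f p * v h"
  by (simp add: tangent_space_def)

lemma tangent_nonsmooth: "v \<in> tangent_space A p \<Longrightarrow> f \<notin> smooth_funs A \<Longrightarrow> v f = 0"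
  by (simp add: tangent_space_def)

lemma tangent_const: "v \<in> tangent_space A p \<Longrightarrow> v (\<lambda>q. c) = 0"
  using tangent_mult[of v p "\<lambda>q. 1" "\<lambda>q. 1"] tangent_scale[of v p "\<lambda>q. 1" c]
  by (simp add: smooth_funs_const)

lemma tangent_minus:
  "v \<in> tangent_space A p \<Longrightarrow> f \<in> smooth_funs A \<Longrightarrow> v (\<lambda>q. - f q) = - v f"
  using tangent_scale[of v p f "-1"] by simp

lemma tangent_diff:
  "v \<in> tangent_space A p \<Longrightarrow> f \<in> smooth_funs A \<Longrightarrow> h \<in> smooth_funs A \<Longrightarrow> v (\<lambda>q. f q - h q) = v f - v h"
  using tangent_add[of v p f "\<lambda>q. - h q"] tangent_minus[of v p h] smooth_funs_minus[of h] by simp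

text \<open>
  The difference of two functions that agree on the manifold equals its product with the indicator
  function of the complement. Both factors are smooth and vanish at \<open>p\<close>, so the Leibniz rule kills
  the product.
\<close>

lemma tangent_cong:
  assumes v: "v \<in> tangent_space A p" and p: "p \<in> points A" and eq: "\<And>q. q \<in> points A \<Longrightarrow> f q = h q"
  shows "v f = v h"
proof (cases "f \<in> smooth_funs A")
  case False
  then have "h \<notin> smooth_funs A" using smooth_funs_cong_imp[of h f] eq by auto
  then show ?thesis using tangent_nonsmooth[OF v] False by simp
next
  case True
  then have h: "h \<in> smooth_funs A" using smooth_funs_cong_imp[of f h] eq by auto
  let ?d = "\<lambda>q. f q - h q" and ?i = "\<lambda>q. if q \<in> points A then 0 else 1 :: real"
  have d: "?d \<in> smooth_funs A" by (rule smooth_funs_diff[OF True h])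
  have i: "?i \<in> smooth_funs A"
    by (rule smooth_funs_cong_imp[OF _ smooth_funs_const[of 0]]) simp
  have "(\<lambda>q. ?d q * ?i q) = ?d" using eq by auto
  then have "v ?d = v (\<lambda>q. ?d q * ?i q)" by simp
  also have "\<dots> = v ?d * ?i p + ?d p * v ?i" by (rule tangent_mult[OF v d i])
  also have "\<dots> = 0" using p eq[OF p] by simp
  finally show ?thesis using tangent_diff[OF v True h] by simp
qed

lemma field_tangent: "X \<in> vector_fields A \<Longrightarrow> p \<in> points A \<Longrightarrow> X p \<in> tangent_space A p"
  by (simp add: vector_fields_def)

lemma field_smooth: "X \<in> vector_fields A \<Longrightarrow> f \<in> smooth_funs A \<Longrightarrow> (\<lambda>p. X p f) \<in> smooth_funs A"
  by (simp add: vector_fields_def)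

lemma field_outside: "X \<in> vector_fields A \<Longrightarrow> p \<notin> points A \<Longrightarrow> X p = (\<lambda>f. 0)"
  by (simp add: vector_fields_def)

lemma vector_fieldsI:
  assumes "\<And>p f h. p \<in> points A \<Longrightarrow> f \<in> smooth_funs A \<Longrightarrow> h \<in> smooth_funs A \<Longrightarrow>
      X p (\<lambda>q. f q + h q) = X p f + X p h"
    and "\<And>p c f. p \<in> points A \<Longrightarrow> f \<in> smooth_funs A \<Longrightarrow> X p (\<lambda>q. c * f q) = c * X p f"
    and "\<And>p f h. p \<in> points A \<Longrightarrow> f \<in> smooth_funs A \<Longrightarrow> h \<in> smooth_funs A \<Longrightarrow>
      X p (\<lambda>q. f q * h q) = X p f * h p + f p * X p h"
    and "\<And>p f. f \<notin> smooth_funs A \<Longrightarrow> X p f = 0"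
    and "\<And>p f. p \<notin> points A \<Longrightarrow> X p f = 0"
    and "\<And>f. f \<in> smooth_funs A \<Longrightarrow> (\<lambda>p. X p f) \<in> smooth_funs A"
  shows "X \<in> vector_fields A"
  unfolding vector_fields_def tangent_space_def using assms by auto

lemma lie_bracket_vector_field:
  assumes X: "X \<in> vector_fields A" and Y: "Y \<in> vector_fields A"
  shows "lie_bracket X Y \<in> vector_fields A"
proof (rule vector_fieldsI)
  fix p f h assume p: "p \<in> points A" and f: "f \<in> smooth_funs A" and h: "h \<in> smooth_funs A"
  note Xp = field_tangent[OF X p] and Yp = field_tangent[OF Y p]
  have add: "Z p (\<lambda>q. Z' q (\<lambda>r. f r + h r)) = Z p (\<lambda>q. Z' q f) + Z p (\<lambda>q. Z' q h)"
    if Z: "Z \<in> vector_fields A" and Z': "Z' \<in> vector_fields A" for Z Z'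
  proof -
    have "Z p (\<lambda>q. Z' q (\<lambda>r. f r + h r)) = Z p (\<lambda>q. Z' q f + Z' q h)"
      by (intro tangent_cong[OF field_tangent[OF Z p] p] tangent_add[OF field_tangent[OF Z'] f h])
    then show ?thesis
      using tangent_add[OF field_tangent[OF Z p] field_smooth[OF Z' f] field_smooth[OF Z' h]] by simp
  qed
  show "lie_bracket X Y p (\<lambda>q. f q + h q) = lie_bracket X Y p f + lie_bracket X Y p h"
    unfolding lie_bracket_def using add[OF X Y] add[OF Y X] by simp
  have mult: "Z p (\<lambda>q. Z' q (\<lambda>r. f r * h r)) =
      Z p (\<lambda>q. Z' q f) * h p + Z' p f * Z p h + (Z p f * Z' p h + f p * Z p (\<lambda>q. Z' q h))"
    if Z: "Z \<in> vector_fields A" and Z': "Z' \<in> vector_fields A" for Z Z'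
  proof -
    note Zp = field_tangent[OF Z p] and sm = field_smooth[OF Z' f] field_smooth[OF Z' h]
    have "Z p (\<lambda>q. Z' q (\<lambda>r. f r * h r)) = Z p (\<lambda>q. Z' q f * h q + f q * Z' q h)"
      by (intro tangent_cong[OF Zp p] tangent_mult[OF field_tangent[OF Z'] f h])
    also have "\<dots> = Z p (\<lambda>q. Z' q f * h q) + Z p (\<lambda>q. f q * Z' q h)"
      by (intro tangent_add[OF Zp] smooth_funs_mult sm f h)
    finally show ?thesis by (simp only: tangent_mult[OF Zp] sm f h)
  qed
  show "lie_bracket X Y p (\<lambda>q. f q * h q) = lie_bracket X Y p f * h p + f p * lie_bracket X Y p h"
    unfolding lie_bracket_def mult[OF X Y] mult[OF Y X] by (simp add: algebra_simps)
next
  fix p c f assume p: "p \<in> points A" and f: "f \<in> smooth_funs A"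
  have "Z p (\<lambda>q. Z' q (\<lambda>r. c * f r)) = c * Z p (\<lambda>q. Z' q f)"
    if Z: "Z \<in> vector_fields A" and Z': "Z' \<in> vector_fields A" for Z Z'
  proof -
    have "Z p (\<lambda>q. Z' q (\<lambda>r. c * f r)) = Z p (\<lambda>q. c * Z' q f)"
      by (intro tangent_cong[OF field_tangent[OF Z p] p] tangent_scale[OF field_tangent[OF Z'] f])
    then show ?thesis using tangent_scale[OF field_tangent[OF Z p] field_smooth[OF Z' f]] by simp
  qed
  then show "lie_bracket X Y p (\<lambda>q. c * f q) = c * lie_bracket X Y p f"
    unfolding lie_bracket_def using X Y by (simp add: right_diff_distrib)
next
  fix p f assume f: "f \<notin> smooth_funs A"
  have "Z q f = 0" if "Z \<in> vector_fields A" for Z q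
    using that f field_tangent[OF that] tangent_nonsmooth field_outside[OF that]
    by (cases "q \<in> points A") auto
  from this[OF X] this[OF Y] have eq: "lie_bracket X Y p f = X p (\<lambda>q. 0) - Y p (\<lambda>q. 0)"
    unfolding lie_bracket_def by simp
  have "Z p (\<lambda>q. 0) = 0" if "Z \<in> vector_fields A" for Z
    using field_tangent[OF that] tangent_const field_outside[OF that]
    by (cases "p \<in> points A") auto
  from this[OF X] this[OF Y] eq show "lie_bracket X Y p f = 0" by simp
next
  fix p f assume "p \<notin> points A"
  then show "lie_bracket X Y p f = 0"
    unfolding lie_bracket_def using field_outside[OF X] field_outside[OF Y] by simp
next
  fix f assume f: "f \<in> smooth_funs A"
  show "(\<lambda>p. lie_bracket X Y p f) \<in> smooth_funs A"
    unfolding lie_bracket_def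
    by (rule smooth_funs_diff[OF field_smooth[OF X field_smooth[OF Y f]] field_smooth[OF Y field_smooth[OF X f]]])
qed

end

lemma field_vanishes:
  assumes A: "smooth_manifold A" and X: "X \<in> vector_fields A" and "\<not> (p \<in> points A \<and> f \<in> smooth_funs A)"
  shows "X p f = 0"
proof (cases "p \<in> points A")
  case True
  then show ?thesis using assms(3) tangent_nonsmooth[OF A field_tangent[OF A X True]] by simp
next
  case False
  then show ?thesis using field_outside[OF A X] by simp
qed

section \<open>Fields supported in a chart\<close>

text \<open>
  The field \<open>b \<partial>\<^sub>e\<close> of the chart \<open>(U, \<phi>)\<close>, extended by zero.
\<close>

definition coordinate_field ::
  "('p, 'e::euclidean_space) atlas \<Rightarrow> 'p set \<Rightarrow> ('p \<Rightarrow> 'e) \<Rightarrow> ('p \<Rightarrow> real) \<Rightarrow> 'e \<Rightarrow> 'p vfield" where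
  "coordinate_field A U \<phi> b e = (\<lambda>p f. if p \<in> U \<and> f \<in> smooth_funs A
     then b p * frechet_derivative (\<lambda>y. f (inv_into U \<phi> y)) (at (\<phi> p)) e else 0)"

lemma coordinate_field_vector_field:
  fixes A :: "('p::{t2_space, second_countable_topology}, 'e::euclidean_space) atlas"
  assumes A: "smooth_manifold A" and U: "(U, \<phi>) \<in> A" and K: "closed K" "K \<inter> points A \<subseteq> U"
    and b: "smooth_on (\<phi> ` U) (\<lambda>y. b (inv_into U \<phi> y))" "\<And>p. p \<in> U \<Longrightarrow> p \<notin> K \<Longrightarrow> b p = 0"
  shows "coordinate_field A U \<phi> b e \<in> vector_fields A"
proof (rule vector_fieldsI[OF A])
  note c = smooth_chart[OF A U]
  let ?l = "\<lambda>f y. f (inv_into U \<phi> y)"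
  have D: "(?l f has_derivative frechet_derivative (?l f) (at (\<phi> p))) (at (\<phi> p))"
    if "f \<in> smooth_funs A" "p \<in> U" for f :: "'p \<Rightarrow> real" and p
    using smooth_on_has_derivative[OF smooth_funsD[OF that(1) U]] that(2) by blast
  {
    fix p f h assume f: "f \<in> smooth_funs A" and h: "h \<in> smooth_funs A"
    show "coordinate_field A U \<phi> b e p (\<lambda>q. f q + h q) =
        coordinate_field A U \<phi> b e p f + coordinate_field A U \<phi> b e p h"
    proof (cases "p \<in> U")
      case True
      have "frechet_derivative (?l (\<lambda>q. f q + h q)) (at (\<phi> p)) =
          (\<lambda>v. frechet_derivative (?l f) (at (\<phi> p)) v + frechet_derivative (?l h) (at (\<phi> p)) v)"
        using frechet_derivative_at[OF has_derivative_add[OF D[OF f True] D[OF h True]]] by simp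
      then show ?thesis
        using True f h smooth_funs_add[OF A f h] by (simp add: coordinate_field_def algebra_simps)
    qed (simp add: coordinate_field_def)
    show "coordinate_field A U \<phi> b e p (\<lambda>q. f q * h q) =
        coordinate_field A U \<phi> b e p f * h p + f p * coordinate_field A U \<phi> b e p h"
    proof (cases "p \<in> U")
      case True
      have "inv_into U \<phi> (\<phi> p) = p" using True c(4) by simp
      then have "frechet_derivative (?l (\<lambda>q. f q * h q)) (at (\<phi> p)) =
          (\<lambda>v. f p * frechet_derivative (?l h) (at (\<phi> p)) v + frechet_derivative (?l f) (at (\<phi> p)) v * h p)"
        using frechet_derivative_at[OF has_derivative_mult[OF D[OF f True] D[OF h True]]] by simp
      then show ?thesis
        using True f h smooth_funs_mult[OF A f h] by (simp add: coordinate_field_def algebra_simps)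
    qed (simp add: coordinate_field_def)
  next
    fix p c f assume f: "f \<in> smooth_funs A"
    show "coordinate_field A U \<phi> b e p (\<lambda>q. c * f q) = c * coordinate_field A U \<phi> b e p f"
    proof (cases "p \<in> U")
      case True
      have "frechet_derivative (?l (\<lambda>q. c * f q)) (at (\<phi> p)) =
          (\<lambda>v. c * frechet_derivative (?l f) (at (\<phi> p)) v)"
        using frechet_derivative_at[OF has_derivative_mult_right[OF D[OF f True], of c]] by simp
      then show ?thesis
        using True f smooth_funs_mult[OF A smooth_funs_const f]
        by (simp add: coordinate_field_def algebra_simps)
    qed (simp add: coordinate_field_def)
  next
    fix f assume f: "f \<in> smooth_funs A"
    show "(\<lambda>p. coordinate_field A U \<phi> b e p f) \<in> smooth_funs A"
    proof (rule smooth_funs_extend[OF A U K])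
      have "smooth_on (\<phi> ` U) (\<lambda>y. b (inv_into U \<phi> y) * frechet_derivative (?l f) (at y) e)"
        by (intro smooth_on_mult c b(1) smooth_on_derivative smooth_funsD[OF f U])
      moreover have "b (inv_into U \<phi> y) * frechet_derivative (?l f) (at y) e =
          coordinate_field A U \<phi> b e (inv_into U \<phi> y) f" if "y \<in> \<phi> ` U" for y
        using that f by (simp add: coordinate_field_def inv_into_into f_inv_into_f)
      ultimately show "smooth_on (\<phi> ` U) (\<lambda>y. coordinate_field A U \<phi> b e (inv_into U \<phi> y) f)"
        by (rule smooth_on_cong[OF c(2)])
    qed (use b(2) in \<open>simp add: coordinate_field_def\<close>)
  }
qed (use smooth_chart[OF A U] in \<open>auto simp: coordinate_field_def\<close>)

section \<open>The product of the half-line with a manifold\<close>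

lemma points_half_line: "points half_line = {0<..}"
  by (simp add: points_def half_line_def)

lemma smooth_funs_half_line: "f \<in> smooth_funs half_line \<longleftrightarrow> smooth_on {0<..} f"
proof -
  have "inv_into {0<..} (\<lambda>t. t) y = y" if "y > 0" for y :: real
    using that inv_into_f_f[of "\<lambda>t::real. t" "{0<..}" y] by (simp add: inj_on_def)
  then have "smooth_on {0<..} (\<lambda>y. f (inv_into {0<..} (\<lambda>t. t) y)) \<longleftrightarrow> smooth_on {0<..} f"
    using smooth_on_cong[OF open_greaterThan[of "0::real"]] by (metis greaterThan_iff)
  then show ?thesis by (simp add: smooth_funs_def half_line_def comp_def)
qed

lemma id_smooth_half_line: "(\<lambda>s. s) \<in> smooth_funs half_line"
  unfolding smooth_funs_half_line
  by (rule smooth_on_bounded_linear) (auto intro: bounded_linear_ident)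

lemma smooth_manifold_half_line: "smooth_manifold half_line"
proof -
  have id: "inv_into {0<..} (\<lambda>t. t) y = y" if "y > 0" for y :: real
    using that inv_into_f_f[of "\<lambda>t::real. t" "{0<..}" y] by (simp add: inj_on_def)
  have "homeomorphism {0::real<..} {0<..} (\<lambda>t. t) (inv_into {0<..} (\<lambda>t. t))"
  proof (rule homeomorphismI)
    show "continuous_on {0::real<..} (inv_into {0<..} (\<lambda>t. t))"
      by (rule continuous_on_eq[OF continuous_on_id]) (simp add: id)
  qed (auto simp: id continuous_on_id)
  moreover have "smooth_on {0::real<..} (\<lambda>y. inv_into {0<..} (\<lambda>t. t) y)"
    by (rule smooth_on_cong[OF _ smooth_on_bounded_linear[OF _ bounded_linear_ident]]) (auto simp: id)
  ultimately show ?thesis by (simp add: smooth_manifold_def half_line_def comp_def)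
qed

lemma d_dt_vector_field: "d_dt \<in> vector_fields half_line"
proof (rule vector_fieldsI[OF smooth_manifold_half_line])
  note H = smooth_manifold_half_line
  have D: "(f has_real_derivative deriv f t) (at t)" and D': "deriv f t = frechet_derivative f (at t) 1"
    if "f \<in> smooth_funs half_line" "t > 0" for f t
  proof -
    have "(f has_derivative frechet_derivative f (at t)) (at t)"
      using smooth_on_has_derivative that smooth_funs_half_line by blast
    moreover from this interpret linear "frechet_derivative f (at t)" by (rule has_derivative_linear)
    have "frechet_derivative f (at t) = (*) (frechet_derivative f (at t) 1)"
    proof
      fix v :: real
      show "frechet_derivative f (at t) v = frechet_derivative f (at t) 1 * v"
        using scale[of v 1] by (simp add: mult.commute)
    qed
    ultimately have d: "(f has_real_derivative frechet_derivative f (at t) 1) (at t)"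
      by (simp add: has_field_derivative_def)
    show "deriv f t = frechet_derivative f (at t) 1" by (rule DERIV_imp_deriv[OF d])
    then show "(f has_real_derivative deriv f t) (at t)" using d by simp
  qed
  fix t :: real and f assume f: "f \<in> smooth_funs half_line"
  {
    fix h assume t: "t \<in> points half_line" and h: "h \<in> smooth_funs half_line"
    then have t0: "t > 0" by (simp add: points_half_line)
    show "d_dt t (\<lambda>q. f q + h q) = d_dt t f + d_dt t h"
      using DERIV_imp_deriv[OF DERIV_add[OF D[OF f t0] D[OF h t0]]] t f h smooth_funs_add[OF H f h]
      by (simp add: d_dt_def)
    show "d_dt t (\<lambda>q. f q * h q) = d_dt t f * h t + f t * d_dt t h"
      using DERIV_imp_deriv[OF DERIV_mult[OF D[OF f t0] D[OF h t0]]] t f h smooth_funs_mult[OF H f h]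
      by (simp add: d_dt_def mult.commute)
  next
    fix c assume t: "t \<in> points half_line"
    then have t0: "t > 0" by (simp add: points_half_line)
    show "d_dt t (\<lambda>q. c * f q) = c * d_dt t f"
      using DERIV_imp_deriv[OF DERIV_cmult[OF D[OF f t0], of c]] t f
        smooth_funs_mult[OF H smooth_funs_const f]
      by (simp add: d_dt_def)
  next
    have "smooth_on {0<..} (\<lambda>t. frechet_derivative f (at t) 1)"
      using f smooth_on_derivative smooth_funs_half_line by blast
    then show "(\<lambda>p. d_dt p f) \<in> smooth_funs half_line"
      unfolding smooth_funs_half_line
      by (rule smooth_on_cong[OF open_greaterThan]) (use f D' in \<open>simp add: d_dt_def points_half_line\<close>)
  }
qed (simp_all add: d_dt_def)

lemma in_points: "p \<in> points A \<longleftrightarrow> (\<exists>U \<phi>. (U, \<phi>) \<in> A \<and> p \<in> U)"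
  by (auto simp: points_def)

lemma chart_product:
  "(W, \<kappa>) \<in> product_manifold half_line F \<longleftrightarrow>
    (\<exists>U \<phi>. (U, \<phi>) \<in> F \<and> W = {0<..} \<times> U \<and> \<kappa> = map_prod (\<lambda>t. t) \<phi>)"
  by (auto simp: product_manifold_def half_line_def)

lemma points_product: "points (product_manifold half_line F) = {0<..} \<times> points F"
proof (rule set_eqI)
  fix p :: "real \<times> 'a"
  have "p \<in> points (product_manifold half_line F) \<longleftrightarrow> (\<exists>U \<phi>. (U, \<phi>) \<in> F \<and> p \<in> {0<..} \<times> U)"
    unfolding in_points chart_product by auto
  also have "\<dots> \<longleftrightarrow> p \<in> {0<..} \<times> points F"
    unfolding mem_Times_iff in_points by auto
  finally show "p \<in> points (product_manifold half_line F) \<longleftrightarrow> p \<in> {0<..} \<times> points F" .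
qed

lemma image_chart_product:
  "map_prod (\<lambda>t. t) \<phi> ` ({0<..} \<times> U) = {0::real<..} \<times> \<phi> ` U"
  by (force simp: image_iff)

lemma inv_chart_product:
  assumes "inj_on \<phi> U" "t > 0" "y \<in> \<phi> ` U"
  shows "inv_into ({0<..} \<times> U) (map_prod (\<lambda>t. t) \<phi>) (t::real, y) = (t, inv_into U \<phi> y)"
proof -
  have "inj_on (map_prod (\<lambda>t. t) \<phi>) ({0::real<..} \<times> U)"
    using assms(1) by (auto simp: inj_on_def)
  moreover have "map_prod (\<lambda>t. t) \<phi> (t, inv_into U \<phi> y) = (t, y)"
    using assms(3) by (simp add: f_inv_into_f)
  ultimately show ?thesis
    using assms(2) inv_into_into[OF assms(3)] inv_into_f_eq by (metis SigmaI greaterThan_iff)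
qed

text \<open>
  The values of a vector field are abstract derivations, so smoothness of its lift jointly in \<open>t\<close>
  and the fibre variable is not immediate. It suffices to work with the fields for which it is
  known: they contain enough fields for the pointwise algebra, and they are closed under the
  operations that occur.
\<close>

definition liftable_fields :: "('q, 'd::euclidean_space) atlas \<Rightarrow> 'q vfield set" where
  "liftable_fields F = {V \<in> vector_fields F.
     lift_fibre half_line F V \<in> vector_fields (product_manifold half_line F)}"

context
  fixes F :: "('q::{t2_space, second_countable_topology}, 'd::euclidean_space) atlas"
    and M :: "(real \<times> 'q, real \<times> 'd) atlas"
  assumes F: "smooth_manifold F"
  defines "M \<equiv> product_manifold half_line F"
begin

lemma open_cylinder: "(U, \<phi>) \<in> F \<Longrightarrow> open ({0::real<..} \<times> \<phi> ` U)"
  by (intro open_Times open_greaterThan smooth_chart[OF F])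

lemma smooth_funs_product:
  "f \<in> smooth_funs M \<longleftrightarrow>
    (\<forall>(U, \<phi>)\<in>F. smooth_on ({0<..} \<times> \<phi> ` U) (\<lambda>z. f (fst z, inv_into U \<phi> (snd z))))"
proof -
  let ?chart = "\<lambda>\<phi> :: 'q \<Rightarrow> 'd. map_prod (\<lambda>t::real. t) \<phi>"
  have eq: "smooth_on (?chart \<phi> ` ({0<..} \<times> U)) (\<lambda>z. f (inv_into ({0<..} \<times> U) (?chart \<phi>) z)) \<longleftrightarrow>
      smooth_on ({0<..} \<times> \<phi> ` U) (\<lambda>z. f (fst z, inv_into U \<phi> (snd z)))" if U: "(U, \<phi>) \<in> F" for U \<phi>
  proof -
    have eq: "f (inv_into ({0<..} \<times> U) (?chart \<phi>) z) = f (fst z, inv_into U \<phi> (snd z))"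
      if "z \<in> {0<..} \<times> \<phi> ` U" for z
      using that inv_chart_product[OF smooth_chart(4)[OF F U], of "fst z" "snd z"] by auto
    show ?thesis
      unfolding image_chart_product
      by (intro iffI; erule smooth_on_cong[OF open_cylinder[OF U]]) (simp_all only: eq)
  qed
  show ?thesis
  proof
    assume f: "f \<in> smooth_funs M"
    have "smooth_on ({0<..} \<times> \<phi> ` U) (\<lambda>z. f (fst z, inv_into U \<phi> (snd z)))" if U: "(U, \<phi>) \<in> F" for U \<phi>
    proof -
      have "({0<..} \<times> U, ?chart \<phi>) \<in> M" unfolding M_def chart_product using U by blast
      from smooth_funsD[OF f this] show ?thesis by (simp only: eq[OF U])
    qed
    then show "\<forall>(U, \<phi>)\<in>F. smooth_on ({0<..} \<times> \<phi> ` U) (\<lambda>z. f (fst z, inv_into U \<phi> (snd z)))"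
      by blast
  next
    assume r: "\<forall>(U, \<phi>)\<in>F. smooth_on ({0<..} \<times> \<phi> ` U) (\<lambda>z. f (fst z, inv_into U \<phi> (snd z)))"
    show "f \<in> smooth_funs M"
    proof (rule smooth_funsI)
      fix W \<kappa> assume "(W, \<kappa>) \<in> M"
      then obtain U \<phi> where U: "(U, \<phi>) \<in> F" and W: "W = {0<..} \<times> U" "\<kappa> = ?chart \<phi>"
        unfolding M_def chart_product by blast
      show "smooth_on (\<kappa> ` W) (\<lambda>y. f (inv_into W \<kappa> y))"
        unfolding W eq[OF U] using r U by blast
    qed
  qed
qed

lemma smooth_funs_productD:
  "f \<in> smooth_funs M \<Longrightarrow> (U, \<phi>) \<in> F \<Longrightarrow>
    smooth_on ({0<..} \<times> \<phi> ` U) (\<lambda>z. f (fst z, inv_into U \<phi> (snd z)))"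
  unfolding smooth_funs_product by fast

lemma smooth_manifold_product: "smooth_manifold M"
  unfolding smooth_manifold_def
proof (intro conjI ballI; clarify)
  fix W \<kappa> assume "(W, \<kappa>) \<in> M"
  then obtain U \<phi> where U: "(U, \<phi>) \<in> F" and W: "W = {0<..} \<times> U" "\<kappa> = map_prod (\<lambda>t. t) \<phi>"
    unfolding M_def chart_product by blast
  note c = smooth_chart[OF F U]
  have cont: "continuous_on U \<phi>" "continuous_on (\<phi> ` U) (inv_into U \<phi>)"
    using c(3) by (auto simp: homeomorphism_def)
  show "open W \<and> open (\<kappa> ` W) \<and> homeomorphism W (\<kappa> ` W) \<kappa> (inv_into W \<kappa>)"
  proof (intro conjI)
    show "open W" unfolding W by (intro open_Times open_greaterThan c)
    show "open (\<kappa> ` W)" unfolding W image_chart_product by (rule open_cylinder[OF U])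
    show "homeomorphism W (\<kappa> ` W) \<kappa> (inv_into W \<kappa>)"
    proof (rule homeomorphismI)
      show "continuous_on W \<kappa>"
        unfolding W map_prod_def split_beta
        by (intro continuous_intros continuous_on_compose2[OF cont(1)]) auto
      have "continuous_on ({0<..} \<times> \<phi> ` U) (\<lambda>z::real \<times> 'd. (fst z, inv_into U \<phi> (snd z)))"
        by (intro continuous_intros continuous_on_compose2[OF cont(2)]) auto
      then show "continuous_on (\<kappa> ` W) (inv_into W \<kappa>)"
        unfolding W image_chart_product
        by (rule continuous_on_eq) (use inv_chart_product[OF c(4)] in auto)
      have "inj_on \<kappa> W" using c(4) by (auto simp: W inj_on_def)
      then show "inv_into W \<kappa> (\<kappa> z) = z" if "z \<in> W" for z using that by simp
      show "inv_into W \<kappa> ` \<kappa> ` W \<subseteq> W" using inv_into_into[of _ \<kappa> W] by blast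
      show "\<kappa> (inv_into W \<kappa> y) = y" if "y \<in> \<kappa> ` W" for y using that by (rule f_inv_into_f)
    qed simp
  qed
next
  fix W \<kappa> W' \<kappa>' assume "(W, \<kappa>) \<in> M" "(W', \<kappa>') \<in> M"
  then obtain U \<phi> V \<psi> where U: "(U, \<phi>) \<in> F" and W: "W = {0<..} \<times> U" "\<kappa> = map_prod (\<lambda>t. t) \<phi>"
    and V: "(V, \<psi>) \<in> F" and W': "W' = {0<..} \<times> V" "\<kappa>' = map_prod (\<lambda>t. t) \<psi>"
    unfolding M_def chart_product by blast
  note cU = smooth_chart[OF F U] and cV = smooth_chart[OF F V]
  let ?O = "\<phi> ` (U \<inter> V)"
  have O: "open ?O" by (rule open_chart_image[OF F U cV(1)])
  then have OS: "open ({0::real<..} \<times> ?O)" by (intro open_Times open_greaterThan)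
  have im: "\<kappa> ` (W \<inter> W') = {0<..} \<times> ?O"
    unfolding W W' Times_Int_Times Int_absorb by (rule image_chart_product)
  have "smooth_on ({0<..} \<times> ?O) (\<lambda>z::real \<times> 'd. (fst z, \<psi> (inv_into U \<phi> (snd z))))"
  proof (intro smooth_on_Pair OS)
    show "smooth_on ({0<..} \<times> ?O) (fst :: real \<times> 'd \<Rightarrow> real)"
      by (intro smooth_on_bounded_linear OS bounded_linear_fst)
    have tr: "smooth_on ?O (\<lambda>y. \<psi> (inv_into U \<phi> y))"
      using transition_smooth[OF F U V] by (simp add: comp_def)
    have snd: "smooth_on ({0<..} \<times> ?O) (snd :: real \<times> 'd \<Rightarrow> 'd)"
      by (intro smooth_on_bounded_linear OS bounded_linear_snd)
    show "smooth_on ({0<..} \<times> ?O) (\<lambda>z::real \<times> 'd. \<psi> (inv_into U \<phi> (snd z)))"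
      by (rule smooth_on_compose[OF OS O tr snd]) auto
  qed
  then show "smooth_on (\<kappa> ` (W \<inter> W')) (\<kappa>' \<circ> inv_into W \<kappa>)"
    unfolding im
    by (rule smooth_on_cong[OF OS])
       (use inv_chart_product[OF cU(4)] in \<open>auto simp: W W'\<close>)
qed

lemma smooth_slice_fibre:
  assumes f: "f \<in> smooth_funs M" and t: "t > 0"
  shows "(\<lambda>y. f (t, y)) \<in> smooth_funs F"
proof (rule smooth_funsI)
  fix U \<phi> assume U: "(U, \<phi>) \<in> F"
  note c = smooth_chart[OF F U]
  have "smooth_on (\<phi> ` U) (\<lambda>y. (t, y))"
    by (intro smooth_on_Pair c smooth_on_const smooth_on_bounded_linear bounded_linear_ident)
  from smooth_on_compose[OF c(2) open_cylinder[OF U] smooth_funs_productD[OF f U] this]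
  show "smooth_on (\<phi> ` U) (\<lambda>y. f (t, inv_into U \<phi> y))" using t by auto
qed

lemma smooth_slice_base:
  assumes f: "f \<in> smooth_funs M" and x: "x \<in> points F"
  shows "(\<lambda>s. f (s, x)) \<in> smooth_funs half_line"
proof -
  obtain U \<phi> where U: "(U, \<phi>) \<in> F" "x \<in> U" using x by (auto simp: points_def)
  have "smooth_on {0<..} (\<lambda>s::real. (s, \<phi> x))"
    by (intro smooth_on_Pair open_greaterThan smooth_on_const smooth_on_bounded_linear bounded_linear_ident)
  from smooth_on_compose[OF open_greaterThan open_cylinder[OF U(1)] smooth_funs_productD[OF f U(1)] this]
  show ?thesis
    unfolding smooth_funs_half_line using U(2) smooth_chart(4)[OF F U(1)] by (auto simp: inv_into_f_f)
qed

lemma smooth_fst: "fst \<in> smooth_funs M"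
  unfolding smooth_funs_product using open_cylinder
  by (auto intro!: smooth_on_bounded_linear bounded_linear_fst)

lemma smooth_snd:
  assumes h: "h \<in> smooth_funs F" shows "(\<lambda>z. h (snd z)) \<in> smooth_funs M"
  unfolding smooth_funs_product
proof clarify
  fix U \<phi> assume U: "(U, \<phi>) \<in> F"
  have "smooth_on ({0<..} \<times> \<phi> ` U) (snd :: real \<times> 'd \<Rightarrow> 'd)"
    by (intro smooth_on_bounded_linear open_cylinder[OF U] bounded_linear_snd)
  from smooth_on_compose[OF open_cylinder[OF U] smooth_chart(2)[OF F U] smooth_funsD[OF h U] this]
  show "smooth_on ({0<..} \<times> \<phi> ` U) (\<lambda>z::real \<times> 'd. h (snd (fst z, inv_into U \<phi> (snd z))))" by auto
qed

lemma slice_has_derivative: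
  assumes f: "f \<in> smooth_funs M" and U: "(U, \<phi>) \<in> F" and t: "t > 0" and x: "x \<in> U"
  shows "((\<lambda>s. f (s, x)) has_real_derivative
    frechet_derivative (\<lambda>z. f (fst z, inv_into U \<phi> (snd z))) (at (t, \<phi> x)) (1, 0)) (at t)"
proof -
  let ?l = "\<lambda>z. f (fst z, inv_into U \<phi> (snd z))"
  have D: "(?l has_derivative frechet_derivative ?l (at (t, \<phi> x))) (at (t, \<phi> x))"
    by (rule smooth_on_has_derivative[OF smooth_funs_productD[OF f U]]) (use t x in auto)
  interpret L: linear "frechet_derivative ?l (at (t, \<phi> x))" using D has_derivative_linear by blast
  have A: "((\<lambda>s. (s, \<phi> x)) has_derivative (\<lambda>v. v *\<^sub>R (1, 0))) (at t)"
    by (auto intro!: derivative_eq_intros)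
  from has_derivative_compose[OF A D] have
    "((\<lambda>s. ?l (s, \<phi> x)) has_derivative (\<lambda>v. v * frechet_derivative ?l (at (t, \<phi> x)) (1, 0))) (at t)"
    by (simp only: L.scale real_scaleR_def)
  moreover have "(\<lambda>s. ?l (s, \<phi> x)) = (\<lambda>s. f (s, x))"
    using x smooth_chart(4)[OF F U] by simp
  moreover have "(\<lambda>v. v * frechet_derivative ?l (at (t, \<phi> x)) (1, 0)) = (*) (frechet_derivative ?l (at (t, \<phi> x)) (1, 0))"
    by (rule ext) (rule mult.commute)
  ultimately show ?thesis unfolding has_field_derivative_def by (simp only:)
qed

lemma slice_differentiable:
  assumes "f \<in> smooth_funs M" "t > 0" "x \<in> points F"
  shows "((\<lambda>s. f (s, x)) has_real_derivative deriv (\<lambda>s. f (s, x)) t) (at t)"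
proof -
  obtain U \<phi> where U: "(U, \<phi>) \<in> F" "x \<in> U" using assms(3) by (auto simp: points_def)
  note d = slice_has_derivative[OF assms(1) U(1) assms(2) U(2)]
  show ?thesis unfolding DERIV_imp_deriv[OF d] by (rule d)
qed

lemma partial_t_eq:
  "partial_t F (t, x) f = (if t > 0 \<and> x \<in> points F \<and> f \<in> smooth_funs M then deriv (\<lambda>s. f (s, x)) t else 0)"
proof (cases "t > 0 \<and> x \<in> points F \<and> f \<in> smooth_funs M")
  case True
  then show ?thesis
    using smooth_slice_base[of f x] unfolding M_def
    by (simp add: partial_t_def lift_base_def pushforward_def d_dt_def points_product points_half_line comp_def)
next
  case False
  then show ?thesis
    unfolding M_def by (auto simp: partial_t_def lift_base_def pushforward_def points_product)
qed

lemma partial_t_vector_field: "partial_t F \<in> vector_fields M"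
proof (rule vector_fieldsI[OF smooth_manifold_product])
  fix p f h assume p: "p \<in> points M" and f: "f \<in> smooth_funs M" and h: "h \<in> smooth_funs M"
  obtain t x where p_eq: "p = (t, x)" by fastforce
  have t: "t > 0" "x \<in> points F" using p by (auto simp: p_eq M_def points_product)
  note df = slice_differentiable[OF f t] and dh = slice_differentiable[OF h t]
  show "partial_t F p (\<lambda>q. f q + h q) = partial_t F p f + partial_t F p h"
    using DERIV_imp_deriv[OF DERIV_add[OF df dh]] t f h smooth_funs_add[OF smooth_manifold_product f h]
    by (simp add: p_eq partial_t_eq)
  show "partial_t F p (\<lambda>q. f q * h q) = partial_t F p f * h p + f p * partial_t F p h"
    using DERIV_imp_deriv[OF DERIV_mult[OF df dh]] t f h smooth_funs_mult[OF smooth_manifold_product f h]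
    by (simp add: p_eq partial_t_eq mult.commute)
next
  fix p c f assume p: "p \<in> points M" and f: "f \<in> smooth_funs M"
  obtain t x where p_eq: "p = (t, x)" by fastforce
  have t: "t > 0" "x \<in> points F" using p by (auto simp: p_eq M_def points_product)
  show "partial_t F p (\<lambda>q. c * f q) = c * partial_t F p f"
    using DERIV_imp_deriv[OF DERIV_cmult[OF slice_differentiable[OF f t], of c]] t f
      smooth_funs_mult[OF smooth_manifold_product smooth_funs_const f]
    by (simp add: p_eq partial_t_eq)
next
  fix f assume f: "f \<in> smooth_funs M"
  show "(\<lambda>p. partial_t F p f) \<in> smooth_funs M"
    unfolding smooth_funs_product
  proof clarify
    fix U \<phi> assume U: "(U, \<phi>) \<in> F"
    note c = smooth_chart[OF F U]
    have "smooth_on ({0<..} \<times> \<phi> ` U)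
        (\<lambda>z. frechet_derivative (\<lambda>z. f (fst z, inv_into U \<phi> (snd z))) (at z) (1, 0))"
      by (rule smooth_on_derivative[OF smooth_funs_productD[OF f U]])
    then show "smooth_on ({0<..} \<times> \<phi> ` U) (\<lambda>z. partial_t F (fst z, inv_into U \<phi> (snd z)) f)"
    proof (rule smooth_on_cong[OF open_cylinder[OF U]])
      fix z assume "z \<in> {0::real<..} \<times> \<phi> ` U"
      then obtain t x where z: "z = (t, \<phi> x)" and t: "t > 0" "x \<in> U" by auto
      then show "frechet_derivative (\<lambda>z. f (fst z, inv_into U \<phi> (snd z))) (at z) (1, 0) =
          partial_t F (fst z, inv_into U \<phi> (snd z)) f"
        using DERIV_imp_deriv[OF slice_has_derivative[OF f U t]] c(4,5) f
        by (auto simp: partial_t_eq)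
    qed
  qed
qed (auto simp: partial_t_eq M_def points_product split: if_splits)

text \<open>
  The splitting of the tangent space of the product. Hadamard's lemma in the first variable gives
  \<open>f (s, y) = f (t, y) + (s - t) h (s, y)\<close> with a smooth function \<open>h\<close>, and a derivation at \<open>(t, x)\<close> sees only
  \<open>h (t, x) = \<partial>\<^sub>t f (t, x)\<close> of the second term. The half-line is convex, so \<open>h\<close> is defined on the whole
  product and no localisation is necessary.
\<close>

lemma tangent_decomposition:
  assumes v: "v \<in> tangent_space M (t, x)" and t: "t > 0" and x: "x \<in> points F"
    and f: "f \<in> smooth_funs M"
  shows "v f = v fst * partial_t F (t, x) f + pushforward F snd v (\<lambda>y. f (t, y))"
proof -
  note M = smooth_manifold_product
  have p: "(t, x) \<in> points M" using t x by (simp add: M_def points_product)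
  define h where "h = (\<lambda>p. integral {0..1} (\<lambda>u. partial_t F (t + u * (fst p - t), snd p) f))"
  have pos: "t + u * (s - t) > 0" if "s > 0" "u \<in> {0..1}" for s u
    using segment_in_interval[of "{0<..}" t s u] t that by simp
  have h_chart: "h (s, y) = integral {0..1} (\<lambda>u. frechet_derivative
      (\<lambda>z. f (fst z, inv_into U \<phi> (snd z))) (at (t + u * (s - t), \<phi> y)) (1, 0))"
    if U: "(U, \<phi>) \<in> F" and y: "y \<in> U" and s: "s > 0" for U \<phi> s y
    unfolding h_def
  proof (rule integral_cong)
    fix u :: real assume u: "u \<in> {0..1}"
    show "partial_t F (t + u * (fst (s, y) - t), snd (s, y)) f = frechet_derivative
      (\<lambda>z. f (fst z, inv_into U \<phi> (snd z))) (at (t + u * (s - t), \<phi> y)) (1, 0)"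
      using DERIV_imp_deriv[OF slice_has_derivative[OF f U pos[OF s u] y]] pos[OF s u]
        smooth_chart(5)[OF F U] y f by (auto simp: partial_t_eq)
  qed
  have h: "h \<in> smooth_funs M"
    unfolding smooth_funs_product
  proof clarify
    fix U \<phi> assume U: "(U, \<phi>) \<in> F"
    let ?D = "\<lambda>z. frechet_derivative (\<lambda>z. f (fst z, inv_into U \<phi> (snd z))) (at z) (1, 0)"
    have "C_on k ({0<..} \<times> \<phi> ` U) (\<lambda>z. integral {0..1} (\<lambda>u. 1 * ?D (t + u * (fst z - t), snd z)))" for k
      using smooth_on_derivative[OF smooth_funs_productD[OF f U], of "(1, 0)"]
      by (intro C_on_integral_segment) (use t smooth_chart(2)[OF F U] in \<open>auto simp: smooth_on_def\<close>)
    then have "smooth_on ({0<..} \<times> \<phi> ` U) (\<lambda>z. integral {0..1} (\<lambda>u. ?D (t + u * (fst z - t), snd z)))"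
      by (simp add: smooth_on_def)
    then show "smooth_on ({0<..} \<times> \<phi> ` U) (\<lambda>z. h (fst z, inv_into U \<phi> (snd z)))"
    proof (rule smooth_on_cong[OF open_cylinder[OF U]])
      fix z assume "z \<in> {0::real<..} \<times> \<phi> ` U"
      then obtain s y where z: "z = (s, \<phi> y)" and s: "s > 0" and y: "y \<in> U" by auto
      then show "integral {0..1} (\<lambda>u. ?D (t + u * (fst z - t), snd z)) = h (fst z, inv_into U \<phi> (snd z))"
        using h_chart[OF U y s] smooth_chart(4)[OF F U] by simp
    qed
  qed
  have f_eq: "f q = f (t, snd q) + (fst q - t) * h q" if "q \<in> points M" for q
  proof -
    obtain s y where q: "q = (s, y)" by fastforce
    have s: "s > 0" "y \<in> points F" using that by (auto simp: q M_def points_product)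
    then obtain U \<phi> where U: "(U, \<phi>) \<in> F" "y \<in> U" by (auto simp: points_def)
    have "C_on 1 ({0<..} \<times> \<phi> ` U) (\<lambda>z. f (fst z, inv_into U \<phi> (snd z)))"
      using smooth_funs_productD[OF f U(1)] unfolding smooth_on_def by blast
    from integral_segment_derivative[OF _ _ _ _ this, of t s "\<phi> y"]
    show ?thesis
      using t s(1) U h_chart[OF U s(1)] smooth_chart(4)[OF F U(1)] by (simp add: q)
  qed
  have ft: "(\<lambda>q. f (t, snd q)) \<in> smooth_funs M"
    by (rule smooth_snd[OF smooth_slice_fibre[OF f t]])
  have dt: "(\<lambda>q. fst q - t) \<in> smooth_funs M"
    by (rule smooth_funs_diff[OF M smooth_fst smooth_funs_const])
  have "v f = v (\<lambda>q. f (t, snd q) + (fst q - t) * h q)"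
    by (rule tangent_cong[OF M v p f_eq])
  also have "\<dots> = v (\<lambda>q. f (t, snd q)) + v (\<lambda>q. (fst q - t) * h q)"
    by (rule tangent_add[OF M v ft smooth_funs_mult[OF M dt h]])
  also have "v (\<lambda>q. (fst q - t) * h q) = v (\<lambda>q. fst q - t) * h (t, x)"
    using tangent_mult[OF M v dt h] by simp
  also have "v (\<lambda>q. fst q - t) = v fst"
    using tangent_diff[OF M v smooth_fst smooth_funs_const] tangent_const[OF M v] by simp
  also have "h (t, x) = partial_t F (t, x) f"
    by (simp add: h_def)
  also have "v (\<lambda>q. f (t, snd q)) = pushforward F snd v (\<lambda>y. f (t, y))"
    using smooth_slice_fibre[OF f t] by (simp add: pushforward_def comp_def)
  finally show ?thesis by simp
qed

lemma lift_fibre_eq: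
  "lift_fibre half_line F V (t, x) f =
    (if t > 0 \<and> x \<in> points F \<and> f \<in> smooth_funs M then V x (\<lambda>y. f (t, y)) else 0)"
  by (auto simp: lift_fibre_def pushforward_def points_product comp_def M_def)

text \<open>
  The lift of \<open>b \<partial>\<^sub>e\<close> is the coordinate field in the direction \<open>(0, e)\<close> of the product chart, with the
  coefficient \<open>b\<close> constant in \<open>t\<close>; this is how the smoothness of the lift is obtained.
\<close>

lemma lift_fibre_coordinate_field:
  assumes U: "(U, \<phi>) \<in> F"
  shows "lift_fibre half_line F (coordinate_field F U \<phi> b e) =
    coordinate_field M ({0<..} \<times> U) (map_prod (\<lambda>t. t) \<phi>) (\<lambda>p. b (snd p)) (0, e)"
proof (intro ext)
  fix p :: "real \<times> 'q" and f
  obtain t x where p: "p = (t, x)" by fastforce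
  note c = smooth_chart[OF F U]
  show "lift_fibre half_line F (coordinate_field F U \<phi> b e) p f =
    coordinate_field M ({0<..} \<times> U) (map_prod (\<lambda>t. t) \<phi>) (\<lambda>p. b (snd p)) (0, e) p f"
  proof (cases "t > 0 \<and> x \<in> U \<and> f \<in> smooth_funs M")
    case True
    then have t: "t > 0" and x: "x \<in> U" and f: "f \<in> smooth_funs M" by auto
    let ?l = "\<lambda>z. f (fst z, inv_into U \<phi> (snd z))"
    have z: "(t, \<phi> x) \<in> {0<..} \<times> \<phi> ` U" using t x by auto
    have D: "(?l has_derivative frechet_derivative ?l (at (t, \<phi> x))) (at (t, \<phi> x))"
      by (rule smooth_on_has_derivative[OF smooth_funs_productD[OF f U] z])
    have "((\<lambda>z. f (inv_into ({0<..} \<times> U) (map_prod (\<lambda>t. t) \<phi>) z)) has_derivative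
        frechet_derivative ?l (at (t, \<phi> x))) (at (t, \<phi> x))"
      by (rule has_derivative_transform_within_open[OF D open_cylinder[OF U] z])
         (use inv_chart_product[OF c(4)] in auto)
    from frechet_derivative_at[OF this] have
      1: "frechet_derivative (\<lambda>z. f (inv_into ({0<..} \<times> U) (map_prod (\<lambda>t. t) \<phi>) z)) (at (t, \<phi> x)) =
        frechet_derivative ?l (at (t, \<phi> x))" by simp
    have "((\<lambda>y. (t, y)) has_derivative (\<lambda>v. (0, v))) (at (\<phi> x))"
      by (auto intro!: derivative_eq_intros)
    from frechet_derivative_at[OF has_derivative_compose[OF this D]] have
      2: "frechet_derivative (\<lambda>y. f (t, inv_into U \<phi> y)) (at (\<phi> x)) =
        (\<lambda>v. frechet_derivative ?l (at (t, \<phi> x)) (0, v))" by simp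
    show ?thesis
      using t x f c(5) smooth_slice_fibre[OF f t] 1 2
      by (auto simp: p lift_fibre_eq coordinate_field_def)
  next
    case False
    then show ?thesis
      by (auto simp: p lift_fibre_eq coordinate_field_def)
  qed
qed

lemma coordinate_field_liftable:
  assumes U: "(U, \<phi>) \<in> F" and K: "closed K" "K \<subseteq> U"
    and b: "smooth_on (\<phi> ` U) (\<lambda>y. b (inv_into U \<phi> y))" "\<And>p. p \<in> U \<Longrightarrow> p \<notin> K \<Longrightarrow> b p = 0"
  shows "coordinate_field F U \<phi> b e \<in> liftable_fields F"
  unfolding liftable_fields_def M_def[symmetric]
proof (intro CollectI conjI)
  note c = smooth_chart[OF F U]
  show "coordinate_field F U \<phi> b e \<in> vector_fields F"
    by (rule coordinate_field_vector_field[OF F U K(1) _ b]) (use K(2) in auto)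
  have UM: "({0<..} \<times> U, map_prod (\<lambda>t. t) \<phi>) \<in> M" unfolding M_def chart_product using U by blast
  show "lift_fibre half_line F (coordinate_field F U \<phi> b e) \<in> vector_fields M"
    unfolding lift_fibre_coordinate_field[OF U]
  proof (rule coordinate_field_vector_field[OF smooth_manifold_product UM, where K="UNIV \<times> K"])
    show "closed (UNIV \<times> K)" using K(1) by (intro closed_Times) auto
    show "(UNIV \<times> K) \<inter> points M \<subseteq> {0<..} \<times> U" using K(2) by (auto simp: M_def points_product)
    show "b (snd p) = 0" if "p \<in> {0<..} \<times> U" "p \<notin> UNIV \<times> K" for p :: "real \<times> 'q"
      using that b(2)[of "snd p"] by (auto simp: mem_Times_iff)
    have "smooth_on ({0<..} \<times> \<phi> ` U) (snd :: real \<times> 'd \<Rightarrow> 'd)"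
      by (intro smooth_on_bounded_linear open_cylinder[OF U] bounded_linear_snd)
    from smooth_on_compose[OF open_cylinder[OF U] c(2) b(1) this]
    have "smooth_on ({0<..} \<times> \<phi> ` U) (\<lambda>z::real \<times> 'd. b (inv_into U \<phi> (snd z)))" by auto
    then show "smooth_on (map_prod (\<lambda>t::real. t) \<phi> ` ({0<..} \<times> U))
        (\<lambda>y. b (snd (inv_into ({0<..} \<times> U) (map_prod (\<lambda>t. t) \<phi>) y)))"
      unfolding image_chart_product
      by (rule smooth_on_cong[OF open_cylinder[OF U]]) (use inv_chart_product[OF c(4)] in auto)
  qed
qed

text \<open>
  The fields are \<open>\<beta> \<partial>\<^sub>1\<close> and \<open>\<beta> \<partial>\<^sub>2\<close> for a bump function \<open>\<beta>\<close> at \<open>x\<close>, and the functions that separate them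
  are the coordinates centred at \<open>x\<close>, multiplied by \<open>\<beta>\<close>. Since these coordinates vanish at \<open>x\<close>, the
  derivative of \<open>\<beta>\<close> does not contribute.
\<close>

lemma independent_liftable_fields:
  assumes "x \<in> points F" "DIM('d) \<ge> 2"
  obtains V W f h where "V \<in> liftable_fields F" "W \<in> liftable_fields F"
    "V x f = 1" "V x h = 0" "W x f = 0" "W x h = 1"
proof -
  obtain U \<phi> where U: "(U, \<phi>) \<in> F" and x: "x \<in> U" using assms(1) by (auto simp: points_def)
  note c = smooth_chart[OF F U]
  obtain e1 :: 'd where e1: "e1 \<in> Basis" using nonempty_Basis by blast
  have "\<not> Basis \<subseteq> {e1}"
    using assms(2) card_mono[of "{e1}" "Basis :: 'd set"] by auto
  then obtain e2 where e2: "e2 \<in> Basis" "e1 \<noteq> e2" by blast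
  note e = e1 e2
  obtain r where r: "r > 0" "cball (\<phi> x) r \<subseteq> \<phi> ` U"
    using c(2) x open_contains_cball by (metis imageI)
  obtain \<beta> :: "'d \<Rightarrow> real" where \<beta>: "\<And>k. C_on k UNIV \<beta>" "\<beta> (\<phi> x) = 1"
    "\<And>y. y \<notin> cball (\<phi> x) r \<Longrightarrow> \<beta> y = 0"
    using bump_function[OF r(1)] by metis
  have sm\<beta>: "smooth_on S \<beta>" for S
    unfolding smooth_on_def using C_on_subset[OF \<beta>(1) subset_UNIV] by blast
  \<comment> \<open>As a compact subset of a Hausdorff space, the support is closed in the whole space.\<close>
  let ?K = "inv_into U \<phi> ` cball (\<phi> x) r"
  have "continuous_on (\<phi> ` U) (inv_into U \<phi>)" using c(3) by (auto simp: homeomorphism_def)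
  then have "continuous_on (cball (\<phi> x) r) (inv_into U \<phi>)" using r(2) continuous_on_subset by blast
  then have "compact ?K" using compact_continuous_image compact_cball by blast
  then have K: "closed ?K" by (rule compact_imp_closed)
  have KU: "?K \<subseteq> U" using r(2) by (auto intro: inv_into_into)
  have notK: "\<phi> p \<notin> cball (\<phi> x) r" if "p \<in> U" "p \<notin> ?K" for p
    using that c(4) inv_into_f_f by (metis image_eqI)
  let ?b = "\<lambda>p. \<beta> (\<phi> p)"
  have b: "smooth_on (\<phi> ` U) (\<lambda>y. ?b (inv_into U \<phi> y))"
    by (rule smooth_on_cong[OF c(2) sm\<beta>]) (simp add: f_inv_into_f)
  let ?V = "\<lambda>e. coordinate_field F U \<phi> ?b e"
  have V: "?V e \<in> liftable_fields F" for e
    by (rule coordinate_field_liftable[OF U K KU b]) (use notK \<beta>(3) in auto)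
  define coord where "coord = (\<lambda>(e::'d) p. if p \<in> U then \<beta> (\<phi> p) * ((\<phi> p - \<phi> x) \<bullet> e) else 0)"
  have coord_chart: "coord e (inv_into U \<phi> y) = \<beta> y * ((y - \<phi> x) \<bullet> e)" if "y \<in> \<phi> ` U" for e y
    using that by (simp add: coord_def inv_into_into f_inv_into_f)
  have coord: "coord e \<in> smooth_funs F" for e
  proof (rule smooth_funs_extend[OF F U K])
    have "smooth_on (\<phi> ` U) (\<lambda>y. \<beta> y * (y \<bullet> e + (- (\<phi> x \<bullet> e))))"
      by (intro smooth_on_mult smooth_on_add c sm\<beta> smooth_on_const smooth_on_bounded_linear
          bounded_linear_inner_left)
    then show "smooth_on (\<phi> ` U) (\<lambda>y. coord e (inv_into U \<phi> y))"
      by (rule smooth_on_cong[OF c(2)]) (simp add: coord_chart inner_diff_left)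
  qed (use KU notK \<beta>(3) in \<open>auto simp: coord_def\<close>)
  have val: "?V e x (coord e') = e \<bullet> e'" for e e'
  proof -
    have d\<beta>: "(\<beta> has_derivative frechet_derivative \<beta> (at (\<phi> x))) (at (\<phi> x))"
      by (rule smooth_on_has_derivative[OF sm\<beta>[of UNIV]]) simp
    have "((\<lambda>y. (y - \<phi> x) \<bullet> e') has_derivative (\<lambda>v. v \<bullet> e')) (at (\<phi> x))"
      by (auto intro!: derivative_eq_intros)
    from has_derivative_mult[OF d\<beta> this]
    have "((\<lambda>y. \<beta> y * ((y - \<phi> x) \<bullet> e')) has_derivative (\<lambda>v. v \<bullet> e')) (at (\<phi> x))"
      using \<beta>(2) by simp
    then have "((\<lambda>y. coord e' (inv_into U \<phi> y)) has_derivative (\<lambda>v. v \<bullet> e')) (at (\<phi> x))"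
      by (rule has_derivative_transform_within_open[OF _ c(2)]) (use x coord_chart in auto)
    from frechet_derivative_at[OF this] show ?thesis
      using x coord[of e'] \<beta>(2) by (simp add: coordinate_field_def fun_eq_iff)
  qed
  show thesis
    by (rule that[OF V[of e1] V[of e2], of "coord e1" "coord e2"])
       (use e coord val in \<open>auto simp: inner_Basis\<close>)
qed

end

section \<open>Connections and metrics\<close>

lemma affine_connection_closed:
  "affine_connection A D \<Longrightarrow> X \<in> vector_fields A \<Longrightarrow> Y \<in> vector_fields A \<Longrightarrow> D X Y \<in> vector_fields A"
  by (simp add: affine_connection_def)

lemma affine_connection_scale_left:
  "affine_connection A D \<Longrightarrow> h \<in> smooth_funs A \<Longrightarrow> X \<in> vector_fields A \<Longrightarrow> Y \<in> vector_fields A \<Longrightarrow>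
    D (vf_scale h X) Y = vf_scale h (D X Y)"
  by (simp add: affine_connection_def)

lemma affine_connection_scale_right:
  "affine_connection A D \<Longrightarrow> h \<in> smooth_funs A \<Longrightarrow> X \<in> vector_fields A \<Longrightarrow> Y \<in> vector_fields A \<Longrightarrow>
    D X (vf_scale h Y) = vf_add (vf_scale (\<lambda>p. X p h) Y) (vf_scale h (D X Y))"
  by (simp add: affine_connection_def)

lemma torsion_free_eq:
  assumes "torsion_free A D" "X \<in> vector_fields A" "Y \<in> vector_fields A"
  shows "D X Y p f = D Y X p f + lie_bracket X Y p f"
proof -
  have "torsion D X Y p f = 0" using assms by (simp add: torsion_free_def vf_zero_def)
  then show ?thesis by (simp add: torsion_def vf_diff_def)
qed

lemma flat_eq:
  assumes "flat A D" "X \<in> vector_fields A" "Y \<in> vector_fields A" "Z \<in> vector_fields A"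
  shows "D X (D Y Z) p f = D Y (D X Z) p f + D (lie_bracket X Y) Z p f"
proof -
  have "curvature D X Y Z p f = 0" using assms by (simp add: flat_def vf_zero_def)
  then show ?thesis by (simp add: curvature_def vf_diff_def)
qed

lemma tangent_space_linear_combination:
  assumes "u \<in> tangent_space A p" "v \<in> tangent_space A p"
  shows "(\<lambda>f. u f + c * v f) \<in> tangent_space A p"
  using assms by (simp add: tangent_space_def algebra_simps)

lemma riemannian_metricD:
  assumes "riemannian_metric A g" "p \<in> points A"
  shows "u \<in> tangent_space A p \<Longrightarrow> v \<in> tangent_space A p \<Longrightarrow> g p u v = g p v u"
    and "u \<in> tangent_space A p \<Longrightarrow> v \<in> tangent_space A p \<Longrightarrow> w \<in> tangent_space A p \<Longrightarrow>
      g p (\<lambda>f. u f + v f) w = g p u w + g p v w"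
    and "u \<in> tangent_space A p \<Longrightarrow> v \<in> tangent_space A p \<Longrightarrow> g p (\<lambda>f. c * u f) v = c * g p u v"
    and "u \<in> tangent_space A p \<Longrightarrow> u \<noteq> (\<lambda>f. 0) \<Longrightarrow> g p u u > 0"
  using assms unfolding riemannian_metric_def by blast+

lemma riemannian_metric_smooth:
  "riemannian_metric A g \<Longrightarrow> X \<in> vector_fields A \<Longrightarrow> Y \<in> vector_fields A \<Longrightarrow>
    (\<lambda>p. g p (X p) (Y p)) \<in> smooth_funs A"
  unfolding riemannian_metric_def by blast

lemma zero_tangent: "(\<lambda>f. 0) \<in> tangent_space A p"
  by (simp add: tangent_space_def)

lemma riemannian_metric_zero:
  assumes "riemannian_metric A g" "p \<in> points A" "v \<in> tangent_space A p"
  shows "g p (\<lambda>f. 0) v = 0" "g p v (\<lambda>f. 0) = 0"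
proof -
  show 1: "g p (\<lambda>f. 0) v = 0" using riemannian_metricD(3)[OF assms(1,2) zero_tangent assms(3), of 0] by simp
  show "g p v (\<lambda>f. 0) = 0" using 1 riemannian_metricD(1)[OF assms(1,2) zero_tangent assms(3)] by simp
qed

section \<open>Complementary symmetric forms on a plane\<close>

text \<open>
  The entries \<open>g\<^sub>i\<^sub>j\<close> are the Gram matrix of an inner product, \<open>a, b, c\<close> the matrix of a symmetric form
  \<open>\<sigma>\<close>, and \<open>\<tau> = s g - \<sigma>\<close>. The four equations are the instances of
  \<open>\<tau>(W, Z) \<sigma>(V, U) = \<tau>(V, Z) \<sigma>(W, U)\<close> on the two basis vectors. They force \<open>\<sigma>\<close> to be
  a multiple of \<open>g\<close>, or make the basis diagonalise both; in either case one of \<open>\<sigma>\<close> and \<open>\<tau>\<close> vanishes.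
\<close>

lemma complementary_forms_dichotomy:
  fixes s g11 g12 g22 a b c :: real
  assumes "s > 0" "g11 > 0" "g22 > 0" "g12\<^sup>2 < g11 * g22"
    and e1: "(s * g22 - c) * a = (s * g12 - b) * b"
    and e2: "(s * g12 - b) * a = (s * g11 - a) * b"
    and e3: "(s * g22 - c) * b = (s * g12 - b) * c"
    and e4: "(s * g12 - b) * b = (s * g11 - a) * c"
  shows "a = 0 \<or> a = s * g11"
proof -
  have p: "g12 * a = g11 * b" using e2 assms(1) by (simp add: algebra_simps)
  have q: "g22 * b = g12 * c" using e3 assms(1) by (simp add: algebra_simps)
  show ?thesis
  proof (cases "g12 = 0")
    case True
    then have "b = 0" using p assms by simp
    then show ?thesis using e1 e4 assms by auto
  next
    case False
    define r where "r = a / g11"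
    have a: "a = r * g11" using assms by (simp add: r_def)
    have b: "b = r * g12" using p assms(2) by (simp add: r_def field_simps)
    have c: "c = r * g22" using q False by (simp add: b mult.commute)
    have "(s - r) * r * (g11 * g22 - g12\<^sup>2) = 0"
      using e1 unfolding a b c by (simp add: algebra_simps power2_eq_square)
    then have "r = s \<or> r = 0" using assms(4) by auto
    then show ?thesis using a by auto
  qed
qed

section \<open>Lifts and duality on a dually flat cone\<close>

text \<open>
  In the cone, \<open>T\<close> and \<open>up V\<close> are the radial field and the lift of \<open>V\<close>, and \<open>fibre_part\<close> is the projection
  of a tangent vector of the cone to the tangent space of \<open>F\<close>.
\<close>

locale dually_flat_cone =
  fixes F :: "('q::{t2_space, second_countable_topology}, 'd::euclidean_space) atlas"
    and gF :: "'q metric_tensor"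
    and N N' :: "'q connection"
    and D D' :: "(real \<times> 'q) connection"
  assumes F: "smooth_manifold F"
    and gF: "riemannian_metric F gF"
    and N: "dually_flat F gF N N'"
    and D: "dually_flat (product_manifold half_line F) (warped_metric half_line dt2 (\<lambda>t. t) F gF) D D'"
    and hor: "\<And>X Y. X \<in> base_lifts half_line F \<Longrightarrow> Y \<in> base_lifts half_line F \<Longrightarrow>
                D X Y \<in> base_lifts half_line F"
    and vert: "\<And>V W. V \<in> vector_fields F \<Longrightarrow> W \<in> vector_fields F \<Longrightarrow>
                ver half_line F (D (lift_fibre half_line F V) (lift_fibre half_line F W)) =
                lift_fibre half_line F (N V W)"
begin

abbreviation M :: "(real \<times> 'q, real \<times> 'd) atlas" where
  "M \<equiv> product_manifold half_line F"

abbreviation G :: "(real \<times> 'q) metric_tensor" where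
  "G \<equiv> warped_metric half_line dt2 (\<lambda>t. t) F gF"

abbreviation T :: "(real \<times> 'q) vfield" where
  "T \<equiv> partial_t F"

abbreviation up :: "'q vfield \<Rightarrow> (real \<times> 'q) vfield" where
  "up \<equiv> lift_fibre half_line F"

abbreviation fibre_part :: "(real \<times> 'q) tangent \<Rightarrow> 'q tangent" where
  "fibre_part \<equiv> pushforward F snd"

lemmas M = smooth_manifold_product[OF F]
  and T_field = partial_t_vector_field[OF F]

lemma D_props:
  shows "affine_connection M D" "affine_connection M D'" "dual_connections M G D D'"
    "torsion_free M D" "torsion_free M D'" "flat M D" "flat M D'"
  using D by (simp_all add: dually_flat_def)

lemma N_props:
  shows "affine_connection F N" "dual_connections F gF N N'" "flat F N"
  using N by (simp_all add: dually_flat_def)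

lemmas D_field = affine_connection_closed[OF D_props(1)]
  and D'_field = affine_connection_closed[OF D_props(2)]
  and N_field = affine_connection_closed[OF N_props(1)]

lemma pointsI: "t > 0 \<Longrightarrow> x \<in> points F \<Longrightarrow> (t, x) \<in> points M"
  by (simp add: points_product)

lemma pointsE:
  assumes "p \<in> points M" obtains t x where "p = (t, x)" "t > 0" "x \<in> points F"
  using assms by (auto simp: points_product)

lemmas field_at = field_tangent[OF M _ pointsI]

lemma G_eq: "G (t, x) u v = u fst * v fst + t\<^sup>2 * gF x (fibre_part u) (fibre_part v)"
  using id_smooth_half_line by (simp add: warped_metric_def dt2_def pushforward_def comp_def)

lemma fibre_part_eqI:
  assumes "v \<in> tangent_space F x" "\<And>f. f \<in> smooth_funs F \<Longrightarrow> u (\<lambda>q. f (snd q)) = v f"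
  shows "fibre_part u = v"
  using assms tangent_nonsmooth[OF F assms(1)] by (auto simp: pushforward_def comp_def)

lemma fibre_part_tangent:
  assumes v: "v \<in> tangent_space M (t, x)" shows "fibre_part v \<in> tangent_space F x"
proof -
  note s = smooth_snd[OF F]
  show ?thesis
    unfolding tangent_space_def
    using tangent_add[OF M v s s] tangent_scale[OF M v s] tangent_mult[OF M v s s]
      smooth_funs_add[OF F] smooth_funs_mult[OF F] smooth_funs_mult[OF F smooth_funs_const]
    by (simp add: pushforward_def comp_def)
qed

lemma G_sym:
  assumes "p \<in> points M" "u \<in> tangent_space M p" "v \<in> tangent_space M p"
  shows "G p u v = G p v u"
proof -
  obtain t x where p: "p = (t, x)" "x \<in> points F" using assms(1) by (rule pointsE)
  show ?thesis
    using riemannian_metricD(1)[OF gF p(2) fibre_part_tangent fibre_part_tangent] assms(2,3)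
    by (simp add: p(1) G_eq)
qed

lemma T_fst: "t > 0 \<Longrightarrow> x \<in> points F \<Longrightarrow> T (t, x) fst = 1"
  using smooth_fst[OF F] by (simp add: partial_t_eq[OF F])

lemma fibre_part_T: "fibre_part (T (t, x)) = (\<lambda>f. 0)"
  by (rule fibre_part_eqI[OF zero_tangent]) (simp add: partial_t_eq[OF F])

lemma G_T:
  assumes "v \<in> tangent_space M (t, x)" "t > 0" "x \<in> points F"
  shows "G (t, x) v (T (t, x)) = v fst" "G (t, x) (T (t, x)) v = v fst"
  using riemannian_metric_zero[OF gF assms(3) fibre_part_tangent[OF assms(1)]] T_fst[OF assms(2,3)]
  by (simp_all add: G_eq fibre_part_T)

lemma liftableD:
  assumes "V \<in> liftable_fields F"
  shows "V \<in> vector_fields F" "up V \<in> vector_fields M"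
  using assms by (simp_all add: liftable_fields_def)

lemma up_eq:
  assumes "t > 0" "x \<in> points F" "f \<in> smooth_funs M"
  shows "up V (t, x) f = V x (\<lambda>y. f (t, y))"
  using assms by (simp add: lift_fibre_eq[OF F])

lemma up_fst:
  assumes "V \<in> vector_fields F" "t > 0" "x \<in> points F" shows "up V (t, x) fst = 0"
  using up_eq[OF assms(2,3) smooth_fst[OF F]] tangent_const[OF F field_tangent[OF F assms(1,3)]] by simp

lemma fibre_part_up:
  assumes "V \<in> vector_fields F" "t > 0" "x \<in> points F"
  shows "fibre_part (up V (t, x)) = V x"
  by (rule fibre_part_eqI[OF field_tangent[OF F assms(1,3)]])
     (simp add: up_eq[OF assms(2,3) smooth_snd[OF F]])

lemma G_up:
  assumes "V \<in> vector_fields F" "t > 0" "x \<in> points F"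
  shows "G (t, x) v (up V (t, x)) = t\<^sup>2 * gF x (fibre_part v) (V x)"
    "G (t, x) (up V (t, x)) v = t\<^sup>2 * gF x (V x) (fibre_part v)"
  by (simp_all add: G_eq up_fst[OF assms] fibre_part_up[OF assms])

text \<open>
  By the splitting of the tangent space, it suffices to test two fields on the coordinate \<open>t\<close> and on
  functions pulled back from the fibre.
\<close>

lemma field_eqI:
  assumes X: "X \<in> vector_fields M" and Y: "Y \<in> vector_fields M"
    and "\<And>t x. t > 0 \<Longrightarrow> x \<in> points F \<Longrightarrow> X (t, x) fst = Y (t, x) fst"
    and "\<And>t x. t > 0 \<Longrightarrow> x \<in> points F \<Longrightarrow> fibre_part (X (t, x)) = fibre_part (Y (t, x))"
  shows "X = Y"
proof (intro ext)
  fix p f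
  show "X p f = Y p f"
  proof (cases "p \<in> points M \<and> f \<in> smooth_funs M")
    case True
    then obtain t x where p: "p = (t, x)" and tx: "t > 0" "x \<in> points F" using pointsE by blast
    have f: "f \<in> smooth_funs M" using True by simp
    note dec = tangent_decomposition[OF F field_tangent[OF M _ pointsI[OF tx]] tx f]
    show ?thesis
      unfolding p dec[OF X] dec[OF Y] assms(3,4)[OF tx] ..
  next
    case False
    from field_vanishes[OF M X this] field_vanishes[OF M Y this] show ?thesis by simp
  qed
qed

text \<open>
  If some smooth field \<open>Z\<close> projects to \<open>P\<close>, then the lift of \<open>P\<close> is \<open>Z - Z(t) T\<close> and hence smooth. This
  makes the fibre connection preserve liftability: \<open>N V W\<close> is the projection of \<open>D\<^sub>V W\<close>.
\<close>

lemma liftableI: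
  assumes P: "P \<in> vector_fields F" and Z: "Z \<in> vector_fields M"
    and eq: "\<And>t x. t > 0 \<Longrightarrow> x \<in> points F \<Longrightarrow> fibre_part (Z (t, x)) = P x"
  shows "P \<in> liftable_fields F"
proof -
  have dec: "up P p f = Z p f - Z p fst * T p f" if p: "p \<in> points M" and f: "f \<in> smooth_funs M" for p f
  proof -
    obtain t x where p': "p = (t, x)" and tx: "t > 0" "x \<in> points F" using p by (rule pointsE)
    show ?thesis
      unfolding p' up_eq[OF tx f]
      using tangent_decomposition[OF F field_tangent[OF M Z pointsI[OF tx]] tx f] eq[OF tx] by simp
  qed
  have "up P \<in> vector_fields M"
  proof (rule vector_fieldsI[OF M])
    fix p f h assume p: "p \<in> points M" and f: "f \<in> smooth_funs M" and h: "h \<in> smooth_funs M"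
    note Zp = field_tangent[OF M Z p] and Tp = field_tangent[OF M T_field p]
    show "up P p (\<lambda>q. f q + h q) = up P p f + up P p h"
      by (simp add: dec[OF p] f h smooth_funs_add[OF M] tangent_add[OF M Zp] tangent_add[OF M Tp] algebra_simps)
    show "up P p (\<lambda>q. f q * h q) = up P p f * h p + f p * up P p h"
      by (simp add: dec[OF p] f h smooth_funs_mult[OF M] tangent_mult[OF M Zp] tangent_mult[OF M Tp] algebra_simps)
  next
    fix p c f assume p: "p \<in> points M" and f: "f \<in> smooth_funs M"
    note Zp = field_tangent[OF M Z p] and Tp = field_tangent[OF M T_field p]
    show "up P p (\<lambda>q. c * f q) = c * up P p f"
      by (simp add: dec[OF p] f smooth_funs_mult[OF M smooth_funs_const] tangent_scale[OF M Zp]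
          tangent_scale[OF M Tp] algebra_simps)
  next
    fix p :: "real \<times> 'q" and f
    obtain t x where p: "p = (t, x)" by fastforce
    show "f \<notin> smooth_funs M \<Longrightarrow> up P p f = 0"
      unfolding p by (simp add: lift_fibre_eq[OF F])
    show "p \<notin> points M \<Longrightarrow> up P p f = 0"
      unfolding p by (auto simp: lift_fibre_eq[OF F] points_product)
  next
    fix f assume f: "f \<in> smooth_funs M"
    have "(\<lambda>p. Z p f - Z p fst * T p f) \<in> smooth_funs M"
      by (rule smooth_funs_diff[OF M field_smooth[OF M Z f] smooth_funs_mult[OF M
            field_smooth[OF M Z smooth_fst[OF F]] field_smooth[OF M T_field f]]])
    then show "(\<lambda>p. up P p f) \<in> smooth_funs M"
      by (rule smooth_funs_cong_imp[OF M, rotated]) (simp add: dec f)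
  qed
  then show ?thesis using P by (simp add: liftable_fields_def)
qed

text \<open>
  The projection \<open>ver\<close> followed by the differential of the second projection is that differential
  itself, so testing the hypothesis on functions pulled back from \<open>F\<close> is enough.
\<close>

lemma fibre_part_D:
  assumes V: "V \<in> vector_fields F" and W: "W \<in> vector_fields F" and tx: "t > 0" "x \<in> points F"
  shows "fibre_part (D (up V) (up W) (t, x)) = N V W x"
proof (rule fibre_part_eqI[OF field_tangent[OF F N_field[OF V W] tx(2)]])
  fix f assume f: "f \<in> smooth_funs F"
  have "ver half_line F (D (up V) (up W)) (t, x) (\<lambda>q. f (snd q)) = up (N V W) (t, x) (\<lambda>q. f (snd q))"
    using vert[OF V W] by simp
  then show "D (up V) (up W) (t, x) (\<lambda>q. f (snd q)) = N V W x f"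
    using f smooth_snd[OF F f] by (simp add: up_eq[OF tx] ver_def pushforward_def comp_def)
qed

lemma N_liftable:
  assumes V: "V \<in> liftable_fields F" and W: "W \<in> liftable_fields F"
  shows "N V W \<in> liftable_fields F"
  by (rule liftableI[OF N_field D_field, of V W "up V" "up W"])
     (use liftableD[OF V] liftableD[OF W] fibre_part_D in auto)

lemma up_lie_bracket:
  assumes V: "V \<in> liftable_fields F" and W: "W \<in> liftable_fields F"
  shows "up (lie_bracket V W) = lie_bracket (up V) (up W)"
proof (intro ext)
  fix p f
  note fields = liftableD[OF V] liftableD[OF W]
  have Mb: "lie_bracket (up V) (up W) \<in> vector_fields M"
    by (rule lie_bracket_vector_field[OF M fields(2,4)])
  show "up (lie_bracket V W) p f = lie_bracket (up V) (up W) p f"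
  proof (cases "p \<in> points M \<and> f \<in> smooth_funs M")
    case True
    then obtain t x where p: "p = (t, x)" and tx: "t > 0" "x \<in> points F" using pointsE by blast
    have f: "f \<in> smooth_funs M" using True by simp
    have inner: "(\<lambda>y. up Z (t, y) f) = (\<lambda>y. Z y (\<lambda>y. f (t, y)))" if "Z \<in> vector_fields F" for Z
      using tx f field_outside[OF F that] by (auto simp: lift_fibre_eq[OF F])
    show ?thesis
      unfolding p up_eq[OF tx f] lie_bracket_def
      by (simp only: up_eq[OF tx field_smooth[OF M fields(2) f]] up_eq[OF tx field_smooth[OF M fields(4) f]]
          inner[OF fields(1)] inner[OF fields(3)])
  next
    case False
    then have "up (lie_bracket V W) p f = 0"
      by (cases p) (auto simp: lift_fibre_eq[OF F] points_product)
    then show ?thesis using field_vanishes[OF M Mb False] by simp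
  qed
qed

text \<open>
  The field \<open>V\<close> is not given in coordinates, so the interchange of partial derivatives is not
  available directly. By the splitting of the tangent space it is needed only for the function \<open>t\<close>
  and for functions of the fibre variable, where one of the two derivatives is zero.
\<close>

lemma lie_bracket_T_up:
  assumes V: "V \<in> liftable_fields F"
  shows "lie_bracket T (up V) = vf_zero"
proof (rule field_eqI)
  note fields = liftableD[OF V]
  show "lie_bracket T (up V) \<in> vector_fields M"
    by (rule lie_bracket_vector_field[OF M T_field fields(2)])
  show "vf_zero \<in> vector_fields M"
    by (rule vector_fieldsI[OF M]) (simp_all add: vf_zero_def smooth_funs_const)
  fix t x assume tx: "t > (0::real)" "x \<in> points F"
  note p = pointsI[OF tx] and Tp = field_tangent[OF M T_field pointsI[OF tx]]
    and Vp = field_tangent[OF M fields(2) pointsI[OF tx]]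
  have "T (t, x) (\<lambda>q. up V q fst) = T (t, x) (\<lambda>q. 0)"
    by (rule tangent_cong[OF M Tp p]) (auto elim!: pointsE simp: up_fst[OF fields(1)])
  moreover have "up V (t, x) (\<lambda>q. T q fst) = up V (t, x) (\<lambda>q. 1)"
    by (rule tangent_cong[OF M Vp p]) (auto elim!: pointsE simp: T_fst)
  ultimately show "lie_bracket T (up V) (t, x) fst = vf_zero (t, x) fst"
    using tangent_const[OF M Tp] tangent_const[OF M Vp] by (simp add: lie_bracket_def vf_zero_def)
  have "fibre_part (lie_bracket T (up V) (t, x)) = (\<lambda>f. 0)"
  proof (rule fibre_part_eqI[OF zero_tangent])
    fix f assume f: "f \<in> smooth_funs F"
    have "T (t, x) (\<lambda>q. up V q (\<lambda>q. f (snd q))) = T (t, x) (\<lambda>q. V (snd q) f)"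
      by (rule tangent_cong[OF M Tp p]) (auto elim!: pointsE simp: up_eq smooth_snd[OF F f])
    also have "\<dots> = 0"
      using smooth_snd[OF F field_smooth[OF F fields(1) f]] by (simp add: partial_t_eq[OF F])
    finally have 1: "T (t, x) (\<lambda>q. up V q (\<lambda>q. f (snd q))) = 0" .
    have "up V (t, x) (\<lambda>q. T q (\<lambda>q. f (snd q))) = up V (t, x) (\<lambda>q. 0)"
      by (rule tangent_cong[OF M Vp p]) (auto elim!: pointsE simp: partial_t_eq[OF F])
    then show "lie_bracket T (up V) (t, x) (\<lambda>q. f (snd q)) = 0"
      using 1 tangent_const[OF M Vp] by (simp add: lie_bracket_def)
  qed
  then show "fibre_part (lie_bracket T (up V) (t, x)) = fibre_part (vf_zero (t, x))"
    by (auto simp: vf_zero_def pushforward_def)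
qed

lemma D_T_up:
  assumes V: "V \<in> liftable_fields F"
  shows "D T (up V) = D (up V) T" "D' T (up V) = D' (up V) T"
  using torsion_free_eq[OF D_props(4) T_field liftableD(2)[OF V]]
    torsion_free_eq[OF D_props(5) T_field liftableD(2)[OF V]]
  by (auto simp: lie_bracket_T_up[OF V] vf_zero_def fun_eq_iff)

lemma D_T_D_up_T:
  assumes V: "V \<in> liftable_fields F"
  shows "D T (D (up V) T) = D (up V) (D T T)" "D' T (D' (up V) T) = D' (up V) (D' T T)"
proof -
  have z: "vf_zero = vf_scale (\<lambda>p. 0) T" by (simp add: vf_zero_def vf_scale_def)
  have "D vf_zero T = vf_zero" "D' vf_zero T = vf_zero"
    unfolding z by (simp_all add: affine_connection_scale_left[OF D_props(1)]
        affine_connection_scale_left[OF D_props(2)] smooth_funs_const T_field) (simp_all add: vf_scale_def)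
  then show "D T (D (up V) T) = D (up V) (D T T)" "D' T (D' (up V) T) = D' (up V) (D' T T)"
    using flat_eq[OF D_props(6) T_field liftableD(2)[OF V] T_field]
      flat_eq[OF D_props(7) T_field liftableD(2)[OF V] T_field]
    by (auto simp: lie_bracket_T_up[OF V] vf_zero_def fun_eq_iff)
qed

text \<open>
  Duality in a form that replaces the inner product of two fields by any function that agrees with
  it on the manifold; the field \<open>X\<close> ignores the values elsewhere.
\<close>

lemma duality:
  assumes "X \<in> vector_fields M" "Y \<in> vector_fields M" "Z \<in> vector_fields M" "p \<in> points M"
    and "\<And>q. q \<in> points M \<Longrightarrow> G q (Y q) (Z q) = \<phi> q"
  shows "X p \<phi> = G p (D X Y p) (Z p) + G p (Y p) (D' X Z p)"
proof -
  have "X p \<phi> = X p (\<lambda>q. G q (Y q) (Z q))"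
    by (rule tangent_cong[OF M field_tangent[OF M assms(1,4)] assms(4)]) (simp add: assms(5))
  then show ?thesis using D_props(3) assms(1-4) by (simp add: dual_connections_def)
qed

lemma duality_swapped:
  assumes X: "X \<in> vector_fields M" and Y: "Y \<in> vector_fields M" and Z: "Z \<in> vector_fields M"
    and p: "p \<in> points M" and \<phi>: "\<And>q. q \<in> points M \<Longrightarrow> G q (Y q) (Z q) = \<phi> q"
  shows "X p \<phi> = G p (D' X Y p) (Z p) + G p (Y p) (D X Z p)"
proof -
  note tan = field_tangent[OF M]
  have "X p \<phi> = G p (D X Z p) (Y p) + G p (Z p) (D' X Y p)"
    by (rule duality[OF X Z Y p]) (use G_sym[OF _ tan[OF Y] tan[OF Z]] \<phi> in auto)
  then show ?thesis
    using G_sym[OF p tan[OF D_field[OF X Z] p] tan[OF Y p]] G_sym[OF p tan[OF Z p] tan[OF D'_field[OF X Y] p]]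
    by simp
qed

text \<open>
  Up to the sign these are the normal components of \<open>D'\<^sub>V W\<close> and \<open>D\<^sub>V W\<close>, that is, the second fundamental
  forms of the slices. In this form they are visibly smooth, whereas \<open>G(D\<^sub>V T, W)\<close> pairs a field that
  depends on \<open>t\<close> with the fibre metric.
\<close>

definition \<sigma> :: "'q vfield \<Rightarrow> 'q vfield \<Rightarrow> real \<times> 'q \<Rightarrow> real" where
  "\<sigma> V W p = - D' (up V) (up W) p fst"

definition \<tau> :: "'q vfield \<Rightarrow> 'q vfield \<Rightarrow> real \<times> 'q \<Rightarrow> real" where
  "\<tau> V W p = - D (up V) (up W) p fst"

lemma \<sigma>_smooth: "V \<in> liftable_fields F \<Longrightarrow> W \<in> liftable_fields F \<Longrightarrow> \<sigma> V W \<in> smooth_funs M"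
  unfolding \<sigma>_def by (intro smooth_funs_minus[OF M] field_smooth[OF M D'_field smooth_fst[OF F]] liftableD)

lemma \<tau>_smooth: "V \<in> liftable_fields F \<Longrightarrow> W \<in> liftable_fields F \<Longrightarrow> \<tau> V W \<in> smooth_funs M"
  unfolding \<tau>_def by (intro smooth_funs_minus[OF M] field_smooth[OF M D_field smooth_fst[OF F]] liftableD)

lemma G_T_up: 
  assumes "V \<in> liftable_fields F" "p \<in> points M"
  shows "G p (T p) (up V p) = 0" "G p (up V p) (T p) = 0"
proof -
  obtain t x where p: "p = (t, x)" and tx: "t > 0" "x \<in> points F" using assms(2) by (rule pointsE)
  note v = field_tangent[OF M liftableD(2)[OF assms(1)] pointsI[OF tx]]
  show "G p (T p) (up V p) = 0" "G p (up V p) (T p) = 0"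
    unfolding p G_T[OF v tx] up_fst[OF liftableD(1)[OF assms(1)] tx] by simp_all
qed

context
  fixes t :: real and x :: 'q
  assumes tx: "t > 0" "x \<in> points F"
begin

text \<open>
  Differentiate \<open>G(T, W) = 0\<close> along \<open>V\<close>: each form is the shape operator of the dual connection.
\<close>

lemma G_D_up_T:
  assumes V: "V \<in> liftable_fields F" and W: "W \<in> liftable_fields F"
  shows "G (t, x) (D (up V) T (t, x)) (up W (t, x)) = \<sigma> V W (t, x)"
    and "G (t, x) (D' (up V) T (t, x)) (up W (t, x)) = \<tau> V W (t, x)"
proof -
  note v = liftableD(2)[OF V] and w = liftableD(2)[OF W]
  have "up V (t, x) (\<lambda>q. 0) = G (t, x) (D (up V) T (t, x)) (up W (t, x)) + G (t, x) (T (t, x)) (D' (up V) (up W) (t, x))"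
    by (rule duality[OF v T_field w pointsI[OF tx]]) (rule G_T_up[OF W])
  then show "G (t, x) (D (up V) T (t, x)) (up W (t, x)) = \<sigma> V W (t, x)"
    using tangent_const[OF M field_at[OF v tx]] G_T(2)[OF field_at[OF D'_field[OF v w] tx] tx] by (simp add: \<sigma>_def)
  have "up V (t, x) (\<lambda>q. 0) = G (t, x) (D' (up V) T (t, x)) (up W (t, x)) + G (t, x) (T (t, x)) (D (up V) (up W) (t, x))"
    by (rule duality_swapped[OF v T_field w pointsI[OF tx]]) (rule G_T_up[OF W])
  then show "G (t, x) (D' (up V) T (t, x)) (up W (t, x)) = \<tau> V W (t, x)"
    using tangent_const[OF M field_at[OF v tx]] G_T(2)[OF field_at[OF D_field[OF v w] tx] tx] by (simp add: \<tau>_def)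
qed

text \<open>
  The difference is the normal component of \<open>[V, W]\<close>, which is tangent to the slices.
\<close>

lemma \<sigma>_sym:
  assumes V: "V \<in> liftable_fields F" and W: "W \<in> liftable_fields F"
  shows "\<sigma> V W (t, x) = \<sigma> W V (t, x)"
proof -
  note v = liftableD[OF V] and w = liftableD[OF W]
  have "lie_bracket (up V) (up W) (t, x) fst = 0"
    unfolding up_lie_bracket[OF V W, symmetric]
    by (rule up_fst[OF lie_bracket_vector_field[OF F v(1) w(1)] tx])
  then show ?thesis
    using torsion_free_eq[OF D_props(5) v(2) w(2), of "(t, x)" fst] by (simp add: \<sigma>_def)
qed

text \<open>
  Differentiate \<open>G(V, W) = t\<^sup>2 g(V, W)\<close> along \<open>T\<close>, using \<open>D\<^sub>T V = D\<^sub>V T\<close> for both connections.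
\<close>

lemma \<sigma>_plus_\<tau>:
  assumes V: "V \<in> liftable_fields F" and W: "W \<in> liftable_fields F"
  shows "\<sigma> V W (t, x) + \<tau> W V (t, x) = 2 * t * gF x (V x) (W x)"
proof -
  note v = liftableD[OF V] and w = liftableD[OF W]
  let ?g = "\<lambda>y. gF y (V y) (W y)"
  let ?h = "\<lambda>q. (fst q)\<^sup>2 * ?g (snd q)"
  have g: "?g \<in> smooth_funs F" by (rule riemannian_metric_smooth[OF gF v(1) w(1)])
  have h: "?h \<in> smooth_funs M"
    unfolding power2_eq_square by (intro smooth_funs_mult[OF M] smooth_fst[OF F] smooth_snd[OF F g])
  have "T (t, x) ?h = 2 * t * ?g x"
  proof -
    have "((\<lambda>s. ?h (s, x)) has_real_derivative 2 * t * ?g x) (at t)"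
      by (auto intro!: derivative_eq_intros)
    from DERIV_imp_deriv[OF this] show ?thesis using tx h by (simp add: partial_t_eq[OF F])
  qed
  moreover have "T (t, x) ?h = G (t, x) (D T (up V) (t, x)) (up W (t, x)) + G (t, x) (up V (t, x)) (D' T (up W) (t, x))"
    by (rule duality[OF T_field v(2) w(2) pointsI[OF tx]])
       (auto elim!: pointsE simp: G_up(1)[OF w(1)] fibre_part_up[OF v(1)])
  moreover have "G (t, x) (up V (t, x)) (D' T (up W) (t, x)) = G (t, x) (D' (up W) T (t, x)) (up V (t, x))"
    unfolding D_T_up(2)[OF W]
    by (rule G_sym[OF pointsI[OF tx] field_at[OF v(2) tx] field_at[OF D'_field[OF w(2) T_field] tx]])
  ultimately show ?thesis
    using G_D_up_T(1)[OF V W] G_D_up_T(2)[OF W V] D_T_up(1)[OF V] by simp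
qed

end

section \<open>Riccati equations along the rays\<close>

lemma D_T_T_base:
  "\<exists>X\<in>vector_fields half_line. \<forall>t>0. \<forall>x\<in>points F. \<forall>f\<in>smooth_funs M.
     D T T (t, x) f = X t (\<lambda>s. f (s, x))"
proof -
  have "T \<in> base_lifts half_line F"
    unfolding base_lifts_def partial_t_def using d_dt_vector_field by blast
  from hor[OF this this] obtain X where X: "X \<in> vector_fields half_line" "D T T = lift_base half_line F X"
    by (auto simp: base_lifts_def)
  show ?thesis
    by (rule bexI[OF _ X(1)]) (simp add: X(2) lift_base_def pushforward_def comp_def points_product)
qed

text \<open>
  The radial component of \<open>D\<^sub>T T\<close>, read off at an arbitrary point of the fibre: since \<open>D\<^sub>T T\<close> is a lift
  from the base, it is the same at all points.
\<close>

definition \<kappa> :: "real \<Rightarrow> real" where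
  "\<kappa> t = D T T (t, SOME x. x \<in> points F) fst"

lemma D_T_T_fst:
  assumes tx: "t > 0" "x \<in> points F" shows "D T T (t, x) fst = \<kappa> t"
proof -
  have x': "(SOME x. x \<in> points F) \<in> points F" using tx(2) by (rule someI)
  obtain X where X: "\<forall>t>0. \<forall>x\<in>points F. \<forall>f\<in>smooth_funs M. D T T (t, x) f = X t (\<lambda>s. f (s, x))"
    using D_T_T_base by blast
  have "D T T (t, y) fst = X t (\<lambda>s. s)" if "y \<in> points F" for y
    using X tx(1) that smooth_fst[OF F] by auto
  from this[OF tx(2)] this[OF x']
  show ?thesis unfolding \<kappa>_def by simp
qed

lemma D_T_T: "D T T = vf_scale (\<lambda>(t, x). \<kappa> t) T"
proof (intro ext)
  fix p :: "real \<times> 'q" and f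
  note Z = D_field[OF T_field T_field]
  show "D T T p f = vf_scale (\<lambda>(t, x). \<kappa> t) T p f"
  proof (cases "p \<in> points M \<and> f \<in> smooth_funs M")
    case True
    then obtain t x where p: "p = (t, x)" and tx: "t > 0" "x \<in> points F" using pointsE by blast
    have f: "f \<in> smooth_funs M" using True by simp
    obtain X where X: "X \<in> vector_fields half_line"
      "\<forall>t>0. \<forall>x\<in>points F. \<forall>f\<in>smooth_funs M. D T T (t, x) f = X t (\<lambda>s. f (s, x))"
      using D_T_T_base by blast
    note Xt = field_tangent[OF smooth_manifold_half_line X(1), of t]
    have "fibre_part (D T T (t, x)) = (\<lambda>f. 0)"
      by (rule fibre_part_eqI[OF zero_tangent])
         (use tx in \<open>simp add: X(2) smooth_snd[OF F] tangent_const[OF smooth_manifold_half_line Xt] points_half_line\<close>)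
    then show ?thesis
      using tangent_decomposition[OF F field_tangent[OF M Z pointsI[OF tx]] tx f]
      by (simp add: p D_T_T_fst[OF tx] vf_scale_def)
  next
    case False
    from field_vanishes[OF M Z this] field_vanishes[OF M T_field this]
    show ?thesis by (simp add: vf_scale_def)
  qed
qed

lemma \<kappa>_smooth: "(\<lambda>(t, x). \<kappa> t) \<in> smooth_funs M"
proof (rule smooth_funs_cong_imp[OF M])
  show "(\<lambda>p. D T T p fst) \<in> smooth_funs M"
    by (rule field_smooth[OF M D_field[OF T_field T_field] smooth_fst[OF F]])
  fix p assume "p \<in> points M"
  then obtain t x where "p = (t, x)" "t > 0" "x \<in> points F" by (rule pointsE)
  then show "D T T p fst = (case p of (t, x) \<Rightarrow> \<kappa> t)" using D_T_T_fst by simp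
qed

lemma fibre_part_scale: "fibre_part (\<lambda>f. c * u f) = (\<lambda>f. c * fibre_part u f)"
  by (auto simp: pushforward_def)

lemma fibre_part_add: "fibre_part (\<lambda>f. u f + v f) = (\<lambda>f. fibre_part u f + fibre_part v f)"
  by (auto simp: pushforward_def)

context
  fixes t :: real and x :: 'q
  assumes tx: "t > 0" "x \<in> points F"
begin

text \<open>
  The vanishing of \<open>R(T, V) T\<close> for \<open>D\<close>, paired with \<open>W\<close>: since \<open>\<kappa>\<close> is constant on the slices,
  \<open>D\<^sub>T D\<^sub>V T = D\<^sub>V (\<kappa> T) = \<kappa> D\<^sub>V T\<close>.
\<close>

lemma T_\<sigma>:
  assumes V: "V \<in> liftable_fields F" and W: "W \<in> liftable_fields F"
  shows "T (t, x) (\<sigma> V W) = \<kappa> t * \<sigma> V W (t, x) +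
    G (t, x) (D (up V) T (t, x)) (D' (up W) T (t, x))"
proof -
  note v = liftableD[OF V] and w = liftableD[OF W]
  note DVT = D_field[OF v(2) T_field]
  have "T (t, x) (\<sigma> V W) = G (t, x) (D T (D (up V) T) (t, x)) (up W (t, x)) +
      G (t, x) (D (up V) T (t, x)) (D' T (up W) (t, x))"
    by (rule duality[OF T_field DVT w(2) pointsI[OF tx]]) (auto elim!: pointsE simp: G_D_up_T(1)[OF _ _ V W])
  moreover have "D T (D (up V) T) (t, x) = (\<lambda>f. \<kappa> t * D (up V) T (t, x) f)"
  proof -
    have "up V (t, x) (\<lambda>(t, x). \<kappa> t) = 0"
      using up_eq[OF tx \<kappa>_smooth] tangent_const[OF F field_tangent[OF F v(1) tx(2)]] by simp
    then show ?thesis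
      unfolding D_T_D_up_T(1)[OF V] D_T_T
        affine_connection_scale_right[OF D_props(1) \<kappa>_smooth v(2) T_field]
      by (simp add: vf_add_def vf_scale_def)
  qed
  ultimately show ?thesis
    using G_D_up_T(1)[OF tx V W] D_T_up(2)[OF W]
      riemannian_metricD(3)[OF gF tx(2) fibre_part_tangent[OF field_at[OF DVT tx]] field_tangent[OF F w(1) tx(2)]]
    by (simp add: G_up(1)[OF w(1) tx] fibre_part_scale)
qed

text \<open>
  Differentiating \<open>G(T, V) = 0\<close> along \<open>T\<close> shows that \<open>D'\<^sub>V T\<close> is tangent to the slices, because \<open>D\<^sub>T T\<close> is
  radial; differentiating \<open>G(T, T) = 1\<close> along \<open>V\<close> transfers this to \<open>D\<^sub>V T\<close>.
\<close>

lemma D_up_T_fst: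
  assumes V: "V \<in> liftable_fields F"
  shows "D (up V) T (t, x) fst = 0"
proof -
  note v = liftableD[OF V]
  have "T (t, x) (\<lambda>q. 0) = G (t, x) (D T T (t, x)) (up V (t, x)) + G (t, x) (T (t, x)) (D' T (up V) (t, x))"
    by (rule duality[OF T_field T_field v(2) pointsI[OF tx]]) (rule G_T_up[OF V])
  moreover have "G (t, x) (D T T (t, x)) (up V (t, x)) = 0"
    using riemannian_metric_zero[OF gF tx(2) field_tangent[OF F v(1) tx(2)]]
    by (simp add: G_up(1)[OF v(1) tx] D_T_T vf_scale_def fibre_part_scale fibre_part_T)
  ultimately have 1: "D' (up V) T (t, x) fst = 0"
    using tangent_const[OF M field_at[OF T_field tx]] D_T_up(2)[OF V]
      G_T(2)[OF field_at[OF D'_field[OF v(2) T_field] tx] tx] by simp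
  have "up V (t, x) (\<lambda>q. 1) = G (t, x) (D (up V) T (t, x)) (T (t, x)) + G (t, x) (T (t, x)) (D' (up V) T (t, x))"
    by (rule duality[OF v(2) T_field T_field pointsI[OF tx]])
       (auto elim!: pointsE simp: G_T(1)[OF field_tangent[OF M T_field pointsI]] T_fst)
  then show ?thesis
    using 1 tangent_const[OF M field_at[OF v(2) tx]] G_T(1)[OF field_at[OF D_field[OF v(2) T_field] tx] tx]
      G_T(2)[OF field_at[OF D'_field[OF v(2) T_field] tx] tx] by simp
qed

lemma D'_T_T_fst: "D' T T (t, x) fst = - \<kappa> t"
proof -
  have "T (t, x) (\<lambda>q. 1) = G (t, x) (D T T (t, x)) (T (t, x)) + G (t, x) (T (t, x)) (D' T T (t, x))"
    by (rule duality[OF T_field T_field T_field pointsI[OF tx]])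
       (auto elim!: pointsE simp: G_T(1)[OF field_tangent[OF M T_field pointsI]] T_fst)
  then show ?thesis
    using tangent_const[OF M field_at[OF T_field tx]] G_T(1)[OF field_at[OF D_field[OF T_field T_field] tx] tx]
      G_T(2)[OF field_at[OF D'_field[OF T_field T_field] tx] tx] D_T_T_fst[OF tx] by simp
qed

lemma D'_T_T_orthogonal:
  assumes P: "P \<in> liftable_fields F"
  shows "G (t, x) (D' T T (t, x)) (up P (t, x)) = 0"
proof -
  note v = liftableD[OF P]
  have "T (t, x) (\<lambda>q. 0) = G (t, x) (D T (up P) (t, x)) (T (t, x)) + G (t, x) (up P (t, x)) (D' T T (t, x))"
    by (rule duality[OF T_field v(2) T_field pointsI[OF tx]]) (rule G_T_up[OF P])
  then show ?thesis
    using tangent_const[OF M field_at[OF T_field tx]] D_T_up(1)[OF P] D_up_T_fst[OF P]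
      G_T(1)[OF field_at[OF D_field[OF v(2) T_field] tx] tx]
      G_sym[OF pointsI[OF tx] field_at[OF v(2) tx] field_at[OF D'_field[OF T_field T_field] tx]] by simp
qed

end

context
  fixes t :: real and x :: 'q
  assumes tx: "t > 0" "x \<in> points F"
begin

text \<open>
  The vanishing of \<open>R'(T, V) T\<close> for \<open>D'\<close>, paired with \<open>W\<close>. The field \<open>D'\<^sub>T T\<close> is not assumed to be
  a lift from the base, so \<open>D'\<^sub>V D'\<^sub>T T\<close> is not computed directly. By duality its product
  with \<open>W\<close> is minus the product of \<open>D'\<^sub>T T\<close> with \<open>D\<^sub>V W\<close>, and for this it is enough to know the radial
  component \<open>- \<kappa>\<close> of \<open>D'\<^sub>T T\<close> and its orthogonality to the lift of \<open>N V W\<close>.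
\<close>

lemma T_\<tau>:
  assumes V: "V \<in> liftable_fields F" and W: "W \<in> liftable_fields F"
  shows "T (t, x) (\<tau> V W) = - \<kappa> t * \<tau> V W (t, x) +
    G (t, x) (D' (up V) T (t, x)) (D (up W) T (t, x))"
proof -
  note v = liftableD[OF V] and w = liftableD[OF W]
  note P = N_liftable[OF V W]
  note ZT = D'_field[OF T_field T_field]
  have "T (t, x) (\<tau> V W) = G (t, x) (D' T (D' (up V) T) (t, x)) (up W (t, x)) +
      G (t, x) (D' (up V) T (t, x)) (D T (up W) (t, x))"
    by (rule duality_swapped[OF T_field D'_field[OF v(2) T_field] w(2) pointsI[OF tx]])
       (auto elim!: pointsE simp: G_D_up_T(2)[OF _ _ V W])
  moreover have "up V (t, x) (\<lambda>q. 0) = G (t, x) (D' (up V) (D' T T) (t, x)) (up W (t, x)) +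
      G (t, x) (D' T T (t, x)) (D (up V) (up W) (t, x))"
    by (rule duality_swapped[OF v(2) ZT w(2) pointsI[OF tx]]) (auto elim!: pointsE simp: D'_T_T_orthogonal[OF _ _ W])
  moreover have "t\<^sup>2 * gF x (fibre_part (D' T T (t, x))) (N V W x) = 0"
    using D'_T_T_orthogonal[OF tx P] unfolding G_up(1)[OF liftableD(1)[OF P] tx] .
  then have "G (t, x) (D' T T (t, x)) (D (up V) (up W) (t, x)) = \<kappa> t * \<tau> V W (t, x)"
    by (simp add: G_eq fibre_part_D[OF v(1) w(1) tx] D'_T_T_fst[OF tx] \<tau>_def)
  ultimately show ?thesis
    using tangent_const[OF M field_at[OF v(2) tx]] D_T_D_up_T(2)[OF V] D_T_up(1)[OF W] by simp
qed

text \<open>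
  On the diagonal the quadratic terms of the two Riccati equations coincide. The difference of the
  equations is therefore \<open>T \<sigma> - T \<tau> = \<kappa> (\<sigma> + \<tau>)\<close>, while \<open>T \<sigma> + T \<tau>\<close> is the derivative of \<open>2 t g\<close>.
\<close>

lemma T_\<sigma>_diagonal:
  assumes V: "V \<in> liftable_fields F"
  shows "T (t, x) (\<sigma> V V) = gF x (V x) (V x) * (1 + \<kappa> t * t)"
proof -
  note v = liftableD[OF V]
  let ?g = "\<lambda>y. gF y (V y) (V y)"
  let ?h = "\<lambda>q. 2 * fst q * ?g (snd q)"
  have g: "?g \<in> smooth_funs F" by (rule riemannian_metric_smooth[OF gF v(1) v(1)])
  have h: "?h \<in> smooth_funs M"
    by (rule smooth_funs_mult[OF M smooth_funs_mult[OF M smooth_funs_const smooth_fst[OF F]] smooth_snd[OF F g]])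
  have "((\<lambda>s. ?h (s, x)) has_real_derivative 2 * ?g x) (at t)"
    by (auto intro!: derivative_eq_intros)
  from DERIV_imp_deriv[OF this] have "T (t, x) ?h = 2 * ?g x"
    using tx h by (simp add: partial_t_eq[OF F])
  moreover have "T (t, x) ?h = T (t, x) (\<lambda>q. \<sigma> V V q + \<tau> V V q)"
    by (rule tangent_cong[OF M field_at[OF T_field tx] pointsI[OF tx]]) (auto elim!: pointsE simp: \<sigma>_plus_\<tau>[OF _ _ V V])
  moreover have "\<dots> = T (t, x) (\<sigma> V V) + T (t, x) (\<tau> V V)"
    by (rule tangent_add[OF M field_at[OF T_field tx] \<sigma>_smooth[OF V V] \<tau>_smooth[OF V V]])
  moreover have "G (t, x) (D' (up V) T (t, x)) (D (up V) T (t, x)) = G (t, x) (D (up V) T (t, x)) (D' (up V) T (t, x))"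
    by (rule G_sym[OF pointsI[OF tx] field_at[OF D'_field[OF v(2) T_field] tx] field_at[OF D_field[OF v(2) T_field] tx]])
  ultimately have "2 * T (t, x) (\<sigma> V V) = 2 * ?g x + \<kappa> t * (\<sigma> V V (t, x) + \<tau> V V (t, x))"
    using T_\<sigma>[OF tx V V] T_\<tau>[OF V V] by (simp add: algebra_simps)
  then show ?thesis using \<sigma>_plus_\<tau>[OF tx V V] by (simp add: algebra_simps)
qed

section \<open>The Gauss equation\<close>

text \<open>
  The projection of \<open>D'\<^sub>V U\<close> to the fibre is \<open>N'\<^sub>V U\<close> by duality on \<open>F\<close> and on the cone. It is
  stated after pairing with a liftable field, since duality only determines these products.
\<close>

lemma gF_N'_eq:
  assumes P: "P \<in> liftable_fields F" and V: "V \<in> liftable_fields F" and U: "U \<in> liftable_fields F"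
  shows "gF x (P x) (fibre_part (D' (up V) (up U) (t, x))) = gF x (P x) (N' V U x)"
proof -
  note v = liftableD[OF V] and u = liftableD[OF U] and q = liftableD[OF P]
  let ?g = "\<lambda>y. gF y (P y) (U y)"
  let ?h = "\<lambda>q. (fst q)\<^sup>2 * ?g (snd q)"
  have g: "?g \<in> smooth_funs F" by (rule riemannian_metric_smooth[OF gF q(1) u(1)])
  have h: "?h \<in> smooth_funs M"
    unfolding power2_eq_square by (intro smooth_funs_mult[OF M] smooth_fst[OF F] smooth_snd[OF F g])
  have "up V (t, x) ?h = t\<^sup>2 * V x ?g"
    using up_eq[OF tx h] tangent_scale[OF F field_tangent[OF F v(1) tx(2)] g] by simp
  moreover have "up V (t, x) ?h = G (t, x) (D (up V) (up P) (t, x)) (up U (t, x)) +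
      G (t, x) (up P (t, x)) (D' (up V) (up U) (t, x))"
    by (rule duality[OF v(2) q(2) u(2) pointsI[OF tx]])
       (auto elim!: pointsE simp: G_up(1)[OF u(1)] fibre_part_up[OF q(1)])
  moreover have "V x ?g = gF x (N V P x) (U x) + gF x (P x) (N' V U x)"
    using N_props(2) v(1) q(1) u(1) tx(2) by (simp add: dual_connections_def)
  ultimately show ?thesis
    using tx(1) by (simp add: G_up(1)[OF u(1) tx] G_up(2)[OF q(1) tx] fibre_part_D[OF v(1) q(1) tx] algebra_simps)
qed

text \<open>
  Differentiate \<open>G(D\<^sub>W Z, U) = t\<^sup>2 g(N\<^sub>W Z, U)\<close> along \<open>V\<close>. The tangential parts combine by duality
  on \<open>F\<close>; the normal parts of \<open>D\<^sub>W Z\<close> and \<open>D'\<^sub>V U\<close> contribute the product of the two forms.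
\<close>

lemma G_D_D:
  assumes V: "V \<in> liftable_fields F" and W: "W \<in> liftable_fields F"
    and Z: "Z \<in> liftable_fields F" and U: "U \<in> liftable_fields F"
  shows "G (t, x) (D (up V) (D (up W) (up Z)) (t, x)) (up U (t, x)) =
    t\<^sup>2 * gF x (N V (N W Z) x) (U x) - \<tau> W Z (t, x) * \<sigma> V U (t, x)"
proof -
  note v = liftableD[OF V] and w = liftableD[OF W] and z = liftableD[OF Z] and u = liftableD[OF U]
  note P = N_liftable[OF W Z]
  note q = liftableD[OF P]
  let ?g = "\<lambda>y. gF y (N W Z y) (U y)"
  let ?h = "\<lambda>q. (fst q)\<^sup>2 * ?g (snd q)"
  have g: "?g \<in> smooth_funs F" by (rule riemannian_metric_smooth[OF gF q(1) u(1)])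
  have h: "?h \<in> smooth_funs M"
    unfolding power2_eq_square by (intro smooth_funs_mult[OF M] smooth_fst[OF F] smooth_snd[OF F g])
  have "up V (t, x) ?h = t\<^sup>2 * V x ?g"
    using up_eq[OF tx h] tangent_scale[OF F field_tangent[OF F v(1) tx(2)] g] by simp
  moreover have "up V (t, x) ?h = G (t, x) (D (up V) (D (up W) (up Z)) (t, x)) (up U (t, x)) +
      G (t, x) (D (up W) (up Z) (t, x)) (D' (up V) (up U) (t, x))"
    by (rule duality[OF v(2) D_field[OF w(2) z(2)] u(2) pointsI[OF tx]])
       (auto elim!: pointsE simp: G_up(1)[OF u(1)] fibre_part_D[OF w(1) z(1)])
  moreover have "G (t, x) (D (up W) (up Z) (t, x)) (D' (up V) (up U) (t, x)) =
      \<tau> W Z (t, x) * \<sigma> V U (t, x) + t\<^sup>2 * gF x (N W Z x) (N' V U x)"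
    by (simp add: G_eq fibre_part_D[OF w(1) z(1) tx] gF_N'_eq[OF P V U] \<tau>_def \<sigma>_def)
  moreover have "V x ?g = gF x (N V (N W Z) x) (U x) + gF x (N W Z x) (N' V U x)"
    using N_props(2) v(1) q(1) u(1) tx(2) by (simp add: dual_connections_def)
  ultimately show ?thesis by (simp add: algebra_simps)
qed

text \<open>
  Antisymmetrise the preceding formula in \<open>V\<close> and \<open>W\<close>: the flatness of \<open>D\<close> and of \<open>N\<close> removes all terms
  except the products of the forms.
\<close>

lemma \<tau>_\<sigma>_exchange:
  assumes V: "V \<in> liftable_fields F" and W: "W \<in> liftable_fields F"
    and Z: "Z \<in> liftable_fields F" and U: "U \<in> liftable_fields F"
  shows "\<tau> W Z (t, x) * \<sigma> V U (t, x) = \<tau> V Z (t, x) * \<sigma> W U (t, x)"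
proof -
  note v = liftableD[OF V] and w = liftableD[OF W] and z = liftableD[OF Z] and u = liftableD[OF U]
  let ?B = "lie_bracket V W"
  have B: "?B \<in> vector_fields F" by (rule lie_bracket_vector_field[OF F v(1) w(1)])
  have upB: "up ?B \<in> vector_fields M"
    unfolding up_lie_bracket[OF V W] by (rule lie_bracket_vector_field[OF M v(2) w(2)])
  let ?A1 = "D (up V) (D (up W) (up Z)) (t, x)" and ?A2 = "D (up W) (D (up V) (up Z)) (t, x)"
    and ?A3 = "D (up ?B) (up Z) (t, x)"
  note tan_U = field_tangent[OF F u(1) tx(2)]
  have tan: "fibre_part ?A2 \<in> tangent_space F x" "fibre_part ?A3 \<in> tangent_space F x"
    by (intro fibre_part_tangent[OF field_at[OF _ tx]] D_field v w z upB)+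
  have "?A1 = (\<lambda>f. ?A2 f + ?A3 f)"
    using flat_eq[OF D_props(6) v(2) w(2) z(2)] by (simp add: up_lie_bracket[OF V W] fun_eq_iff)
  then have "G (t, x) ?A1 (up U (t, x)) = G (t, x) ?A2 (up U (t, x)) + G (t, x) ?A3 (up U (t, x))"
    by (simp add: G_up(1)[OF u(1) tx] fibre_part_add riemannian_metricD(2)[OF gF tx(2) tan tan_U] distrib_left)
  moreover have "G (t, x) ?A3 (up U (t, x)) = t\<^sup>2 * gF x (N ?B Z x) (U x)"
    by (simp add: G_up(1)[OF u(1) tx] fibre_part_D[OF B z(1) tx])
  moreover have "gF x (N V (N W Z) x) (U x) = gF x (N W (N V Z) x) (U x) + gF x (N ?B Z x) (U x)"
  proof -
    have "N V (N W Z) x = (\<lambda>f. N W (N V Z) x f + N ?B Z x f)"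
      using flat_eq[OF N_props(3) v(1) w(1) z(1)] by (simp add: fun_eq_iff)
    then show ?thesis
      using riemannian_metricD(2)[OF gF tx(2) field_tangent[OF F N_field[OF w(1) N_field[OF v(1) z(1)]] tx(2)]
          field_tangent[OF F N_field[OF B z(1)] tx(2)] tan_U] by simp
  qed
  ultimately show ?thesis
    using G_D_D[OF V W Z U] G_D_D[OF W V Z U] by (simp add: algebra_simps)
qed

lemma \<sigma>_dichotomy:
  assumes V: "V \<in> liftable_fields F" and W: "W \<in> liftable_fields F"
    and indep: "V x f = 1" "V x h = 0" "W x f = 0" "W x h = 1"
  shows "\<sigma> V V (t, x) = 0 \<or> \<sigma> V V (t, x) = 2 * t * gF x (V x) (V x)"
proof -
  let ?g = "\<lambda>A B. gF x (A x) (B x)" and ?s = "\<lambda>A B. \<sigma> A B (t, x)"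
  note tV = field_tangent[OF F liftableD(1)[OF V] tx(2)] and tW = field_tangent[OF F liftableD(1)[OF W] tx(2)]
  have \<tau>: "\<tau> A B (t, x) = 2 * t * ?g B A - ?s B A" if "A \<in> liftable_fields F" "B \<in> liftable_fields F" for A B
    using \<sigma>_plus_\<tau>[OF tx that(2,1)] by simp
  have sym: "?s W V = ?s V W" "?g W V = ?g V W"
    using \<sigma>_sym[OF tx V W] riemannian_metricD(1)[OF gF tx(2) tV tW] by simp_all
  have "V x \<noteq> (\<lambda>f. 0)" "W x \<noteq> (\<lambda>f. 0)" using indep by auto
  then have pos: "?g V V > 0" "?g W W > 0"
    using riemannian_metricD(4)[OF gF tx(2)] tV tW by simp_all
  have cauchy_schwarz: "(?g V W)\<^sup>2 < ?g V V * ?g W W"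
  proof -
    \<comment> \<open>The component of \<open>W\<close> orthogonal to \<open>V\<close> is nonzero, since \<open>h\<close> detects it.\<close>
    let ?c = "- ?g V W / ?g V V"
    let ?u = "\<lambda>f. W x f + ?c * V x f"
    have tcV: "(\<lambda>f. ?c * V x f) \<in> tangent_space F x"
      using tangent_space_linear_combination[OF zero_tangent tV, of ?c] by simp
    have u: "?u \<in> tangent_space F x" by (rule tangent_space_linear_combination[OF tW tV])
    have "?u h = 1" using indep by simp
    then have "?u \<noteq> (\<lambda>f. 0)" by (metis zero_neq_one)
    then have "gF x ?u ?u > 0" using riemannian_metricD(4)[OF gF tx(2) u] by simp
    moreover have lin: "gF x ?u w = gF x (W x) w + ?c * gF x (V x) w" if "w \<in> tangent_space F x" for w
      using riemannian_metricD(2)[OF gF tx(2) tW tcV that] riemannian_metricD(3)[OF gF tx(2) tV that, of ?c] by simp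
    moreover have "gF x (W x) ?u = gF x ?u (W x)" "gF x (V x) ?u = gF x ?u (V x)"
      using riemannian_metricD(1)[OF gF tx(2) u] tV tW by simp_all
    ultimately have "?g W W + ?c * ?g V W + ?c * (?g W V + ?c * ?g V V) > 0"
      using u tV tW by simp
    then have "?g W W - (?g V W)\<^sup>2 / ?g V V > 0"
      using pos(1) sym(2) by (simp add: field_simps power2_eq_square)
    then show ?thesis using pos(1) by (simp add: field_simps)
  qed
  show ?thesis
  proof (rule complementary_forms_dichotomy[OF _ pos cauchy_schwarz, where s="2 * t" and b="?s V W" and c="?s W W"])
    show "2 * t > 0" using tx by simp
    show "(2 * t * ?g W W - ?s W W) * ?s V V = (2 * t * ?g V W - ?s V W) * ?s V W"
      using \<tau>_\<sigma>_exchange[OF V W W V] by (simp add: \<tau> V W sym)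
    show "(2 * t * ?g V W - ?s V W) * ?s V V = (2 * t * ?g V V - ?s V V) * ?s V W"
      using \<tau>_\<sigma>_exchange[OF V W V V] by (simp add: \<tau> V W sym)
    show "(2 * t * ?g W W - ?s W W) * ?s V W = (2 * t * ?g V W - ?s V W) * ?s W W"
      using \<tau>_\<sigma>_exchange[OF V W W W] by (simp add: \<tau> V W sym)
    show "(2 * t * ?g V W - ?s V W) * ?s V W = (2 * t * ?g V V - ?s V V) * ?s W W"
      using \<tau>_\<sigma>_exchange[OF V W V W] by (simp add: \<tau> V W sym)
  qed
qed

end

text \<open>
  For a field \<open>V\<close> with \<open>V x \<noteq> 0\<close>, the quotient of \<open>\<sigma>(V, V)\<close> by \<open>2 t g(V, V)\<close> is a continuous function of
  \<open>t\<close> with values in \<open>{0, 1}\<close> and hence constant. The differential equation for \<open>\<sigma>(V, V)\<close> then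
  determines \<open>\<kappa>\<close>.
\<close>

lemma \<kappa>_dichotomy:
  assumes "points F \<noteq> {}" "DIM('d) \<ge> 2"
  shows "(\<forall>t>0. \<kappa> t = 1 / t) \<or> (\<forall>t>0. \<kappa> t = - 1 / t)"
proof -
  obtain x where x: "x \<in> points F" using assms(1) by blast
  obtain V W f h where V: "V \<in> liftable_fields F" and W: "W \<in> liftable_fields F"
    and indep: "V x f = 1" "V x h = 0" "W x f = 0" "W x h = 1"
    using independent_liftable_fields[OF F x assms(2)] by metis
  let ?g = "gF x (V x) (V x)"
  have "V x \<noteq> (\<lambda>f. 0)" using indep by auto
  then have g: "?g > 0"
    using riemannian_metricD(4)[OF gF x field_tangent[OF F liftableD(1)[OF V] x]] by simp
  let ?y = "\<lambda>t. \<sigma> V V (t, x)"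
  have dy: "(?y has_real_derivative ?g * (1 + \<kappa> t * t)) (at t)" if "t > 0" for t
    using slice_differentiable[OF F \<sigma>_smooth[OF V V] that x] T_\<sigma>_diagonal[OF that x V]
      that x \<sigma>_smooth[OF V V] by (simp add: partial_t_eq[OF F])
  define r where "r = (\<lambda>t. ?y t / (2 * t * ?g))"
  have r01: "r t = 0 \<or> r t = 1" if "t > 0" for t
    using \<sigma>_dichotomy[OF that x V W indep] that g by (auto simp: r_def)
  have "continuous_on {0<..} ?y"
    by (intro continuous_at_imp_continuous_on ballI) (use dy DERIV_isCont in auto)
  then have "continuous_on {0<..} r"
    unfolding r_def using g by (intro continuous_intros) auto
  moreover have "finite (r ` {0<..})"
    by (rule finite_subset[of _ "{0, 1}"]) (use r01 in auto)
  ultimately have "r constant_on {0<..}"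
    using continuous_finite_range_constant[of "{0<..}" r] connected_Ioi[of 0] by blast
  then obtain c where c: "\<And>t. t > 0 \<Longrightarrow> r t = c" by (auto simp: constant_on_def)
  have c01: "c = 0 \<or> c = 1" using r01[of 1] c[of 1] by simp
  have "1 + \<kappa> t * t = 2 * c" if t: "t > 0" for t
  proof -
    have "((\<lambda>t. c * (2 * t * ?g)) has_real_derivative c * (2 * ?g)) (at t)"
      by (auto intro!: derivative_eq_intros)
    then have "(?y has_real_derivative c * (2 * ?g)) (at t)"
    proof (rule has_field_derivative_transform_within_open[OF _ open_greaterThan[of 0]])
      show "c * (2 * s * ?g) = ?y s" if "s \<in> {0<..}" for s
        using c[of s] that g by (auto simp: r_def field_simps)
    qed (use t in simp)
    from DERIV_unique[OF dy[OF t] this] have "?g * (1 + \<kappa> t * t) = ?g * (2 * c)" by (simp add: mult.commute)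
    then show ?thesis using g by simp
  qed
  then have "\<kappa> t = (2 * c - 1) / t" if "t > 0" for t
    using that by (simp add: field_simps)
  then show ?thesis using c01 by auto
qed

end

theorem theorem4p1:
  fixes F :: "('q::{t2_space, second_countable_topology}, 'd::euclidean_space) atlas"
    and gF :: "'q metric_tensor"
    and N N' :: "'q connection"
    and M :: "(real \<times> 'q, real \<times> 'd) atlas"
    and G :: "(real \<times> 'q) metric_tensor"
    and D D' :: "(real \<times> 'q) connection"
  assumes F: "smooth_manifold F" "points F \<noteq> {}" "DIM('d) \<ge> 2"
    and gF: "riemannian_metric F gF"
    and N: "dually_flat F gF N N'"
    and M: "M = product_manifold half_line F"
    and G: "G = warped_metric half_line dt2 (\<lambda>t. t) F gF"
    and D: "dually_flat M G D D'"
    and hor: "\<And>X Y. X \<in> base_lifts half_line F \<Longrightarrow> Y \<in> base_lifts half_line F \<Longrightarrow>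
                D X Y \<in> base_lifts half_line F"
    and vert: "\<And>V W. V \<in> vector_fields F \<Longrightarrow> W \<in> vector_fields F \<Longrightarrow>
                ver half_line F (D (lift_fibre half_line F V) (lift_fibre half_line F W)) =
                lift_fibre half_line F (N V W)"
  shows "(\<exists>k. D (partial_t F) (partial_t F) = vf_scale (\<lambda>(t, x). k t) (partial_t F)) \<and>
    (\<forall>k. D (partial_t F) (partial_t F) = vf_scale (\<lambda>(t, x). k t) (partial_t F) \<longrightarrow>
       (\<forall>t>0. k t = 1 / t) \<or> (\<forall>t>0. k t = - 1 / t)) \<and>
    (D (partial_t F) (partial_t F) = vf_scale (\<lambda>(t, x). 1 / t) (partial_t F) \<or>
     D (partial_t F) (partial_t F) = vf_scale (\<lambda>(t, x). - 1 / t) (partial_t F))"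
proof -
  interpret cone: dually_flat_cone F gF N N' D D'
    by unfold_locales (use F(1) gF N D hor vert in \<open>simp_all add: M G\<close>)
  let ?T = "partial_t F"
  have coefficient: "k t = cone.\<kappa> t"
    if "D ?T ?T = vf_scale (\<lambda>(t, x). k t) ?T" "t > 0" for k t
  proof -
    obtain x where x: "x \<in> points F" using F(2) by blast
    show ?thesis
      using cone.D_T_T_fst[OF that(2) x] cone.T_fst[OF that(2) x] by (simp add: that(1) vf_scale_def)
  qed
  have field: "D ?T ?T = vf_scale (\<lambda>(t, x). k t) ?T" if "\<And>t. t > 0 \<Longrightarrow> cone.\<kappa> t = k t" for k
    unfolding cone.D_T_T using that by (auto simp: vf_scale_def fun_eq_iff partial_t_eq[OF F(1)])
  show ?thesis
    using cone.\<kappa>_dichotomy[OF F(2,3)] cone.D_T_T coefficient field[of "\<lambda>t. 1 / t"] field[of "\<lambda>t. - 1 / t"]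
    by (intro conjI allI impI) (blast, metis, blast)
qed

end
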